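(* Let $(X,d,\mu)$ be a complete, connected metric measure space equipped with a doubling measure. Let $0<s<1$. Let $\Omega\subset X$ be a nonempty open set. Then $u^\wedge$ is lower semicontinuous on $\Omega$ for every $s$-superminimizer $u$ in $\Omega$, and $u^\vee$ is upper semicontinuous on $\Omega$ for every $s$-subminimizer $u$ in $\Omega$.
   Context: A metric measure space $(X,d,\mu)$ is a nonempty separable metric space $(X,d)$ with a locally finite Borel-regular outer measure $\mu$ on $X$. $B(x,r)$ is the open ball with center $x$ and radius $r>0$. It is equipped with a doubling measure if there is a doubling constant $C_\mu>0$ such that $0<\mu(B(x,r))<\infty$ and $\mu(B(x,2r))\le C_\mu\mu(B(x,r))$ for all balls $B(x,r)$. Write $B_{x,y}:=B(x,d(x,y))\cup B(y,d(x,y))$ and $\Omega^c:=X\setminus\Omega$. For an open set $\Omega\subset X$ and measurable $u:\Omega\to[-\infty,\infty]$ let $$\|u\|_{\dot W^{s,1}(\Omega)}:=\int_\Omega\int_\Omega\frac{|u(x)-u(y)|}{\mu(B_{x,y})d(x,y)^s}\,d\mu(x)\,d\mu(y),\qquad \|u\|_{W^{s,1}(\Omega)}:=\|u\|_{L^1(\Omega)}+\|u\|_{\dot W^{s,1}(\Omega)};$$ $\dot W^{s,1}(\Omega)$ and $W^{s,1}(\Omega)$ are the spaces of measurable functions on $\Omega$ for which the respective quantity is finite. $W^{s,1}_0(\Omega)$ is the set of $u\in W^{s,1}(X)$ with $u=0$ a.e. on $\Omega^c$. For measurable functions $u,v$ on $X$ let $$F(u,v):=\left(\int_\Omega\int_\Omega+2\int_\Omega\int_{\Omega^c}\right)\frac{|u(x)-u(y)|-|v(x)-v(y)|}{\mu(B_{x,y})d(x,y)^s}\,d\mu(x)\,d\mu(y).$$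 A measurable function $u:X\to[-\infty,\infty]$ is an $s$-subminimizer (resp. $s$-superminimizer) in $\Omega$ if $u\in\dot W^{s,1}(\Omega)$ and $F(u,u+\eta)\le 0$ for every nonpositive (resp. nonnegative) $\eta\in W^{s,1}_0(\Omega)$. The lower and upper approximate limits of $u:X\to[-\infty,\infty]$ at $x\in X$ are $$u^\wedge(x):=\sup\left\{t\in\mathbb R:\lim_{r\to0^+}\frac{\mu(\{y\in B(x,r):u(y)<t\})}{\mu(B(x,r))}=0\right\},$$ $$u^\vee(x):=\inf\left\{t\in\mathbb R:\lim_{r\to0^+}\frac{\mu(\{y\in B(x,r):u(y)>t\})}{\mu(B(x,r))}=0\right\}.$$ *)

theory Defs
  imports "HOL-Analysis.Analysis"
begin

text \<open>
  The space \<open>X\<close> is the universe of a type of class \<open>metric_space\<close> (hence nonempty); completeness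
  and separability are provided by the class \<open>polish_space\<close>. The measure is an outer measure
  defined on all subsets of \<open>X\<close>.
\<close>

definition locally_finite_outer :: "('a::metric_space set \<Rightarrow> ennreal) \<Rightarrow> bool" where
  "locally_finite_outer \<mu> \<longleftrightarrow> (\<forall>x. \<exists>r>0. \<mu> (ball x r) < \<infinity>)"

text \<open>
  Borel regular: Borel sets are measurable in the sense of Caratheodory, and every set has a Borel
  superset of the same measure. The library's \<open>countably_subadditive\<close> speaks only about disjoint
  families, which, given monotonicity, amounts to the usual axiom.
\<close>

definition borel_regular_outer :: "('a::metric_space set \<Rightarrow> ennreal) \<Rightarrow> bool" where
  "borel_regular_outer \<mu> \<longleftrightarrow>
     outer_measure_space UNIV \<mu> \<and>
     sets borel \<subseteq> lambda_system UNIV UNIV \<mu> \<and>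
     (\<forall>A. \<exists>B\<in>sets borel. A \<subseteq> B \<and> \<mu> B = \<mu> A)"

definition doubling :: "('a::metric_space set \<Rightarrow> ennreal) \<Rightarrow> bool" where
  "doubling \<mu> \<longleftrightarrow>
     (\<exists>C::real. C > 0 \<and>
       (\<forall>x r. r > 0 \<longrightarrow> 0 < \<mu> (ball x r) \<and> \<mu> (ball x r) < \<infinity> \<and>
                       \<mu> (ball x (2 * r)) \<le> ennreal C * \<mu> (ball x r)))"

text \<open>
  The restriction of an outer measure to its Caratheodory-measurable sets. Measurability,
  integrals and ``almost everywhere'' refer to this (complete) measure.
\<close>

definition outer_to_measure :: "('a set \<Rightarrow> ennreal) \<Rightarrow> 'a measure" where
  "outer_to_measure \<mu> = measure_of UNIV (lambda_system UNIV UNIV \<mu>) \<mu>"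

lemma
  assumes "outer_measure_space UNIV \<mu>"
  shows space_outer_to_measure: "space (outer_to_measure \<mu>) = UNIV"
    and sets_outer_to_measure: "sets (outer_to_measure \<mu>) = lambda_system UNIV UNIV \<mu>"
    and emeasure_outer_to_measure:
      "A \<in> lambda_system UNIV UNIV \<mu> \<Longrightarrow> emeasure (outer_to_measure \<mu>) A = \<mu> A"
proof -
  have ms: "measure_space UNIV (lambda_system UNIV UNIV \<mu>) \<mu>"
    using sigma_algebra.caratheodory_lemma[OF sigma_algebra_Pow, of UNIV \<mu>] assms by simp
  then have sa: "sigma_algebra UNIV (lambda_system UNIV UNIV \<mu>)"
    by (simp add: measure_space_def)
  show "space (outer_to_measure \<mu>) = UNIV"
    by (simp add: outer_to_measure_def space_measure_of_conv)
  show sets: "sets (outer_to_measure \<mu>) = lambda_system UNIV UNIV \<mu>"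
    by (simp add: outer_to_measure_def sets_measure_of_conv sigma_algebra.sigma_sets_eq[OF sa])
  show "emeasure (outer_to_measure \<mu>) A = \<mu> A" if "A \<in> lambda_system UNIV UNIV \<mu>"
    using ms that sets
    by (intro emeasure_measure_of[OF outer_to_measure_def]) (auto simp: measure_space_def)
qed

definition ball_pair :: "'a::metric_space \<Rightarrow> 'a \<Rightarrow> 'a set" where
  "ball_pair x y = ball x (dist x y) \<union> ball y (dist x y)"

definition frac_weight :: "('a::metric_space set \<Rightarrow> ennreal) \<Rightarrow> real \<Rightarrow> 'a \<Rightarrow> 'a \<Rightarrow> ennreal" where
  "frac_weight \<mu> s x y = \<mu> (ball_pair x y) * ennreal (dist x y powr s)"

text \<open>
  Conventions: \<open>\<bar>\<infinity> - \<infinity>\<bar> = \<infinity>\<close> (arithmetic of \<open>ereal\<close>) in \<open>\<bar>u x - u y\<bar>\<close>, and \<open>0 / 0 = 0\<close> on the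
  diagonal, where the weight vanishes.
\<close>

definition frac_seminorm ::
    "('a::metric_space set \<Rightarrow> ennreal) \<Rightarrow> real \<Rightarrow> 'a set \<Rightarrow> ('a \<Rightarrow> ereal) \<Rightarrow> ennreal" where
  "frac_seminorm \<mu> s \<Omega> u =
     (\<integral>\<^sup>+y\<in>\<Omega>. (\<integral>\<^sup>+x\<in>\<Omega>. (e2ennreal \<bar>u x - u y\<bar> / frac_weight \<mu> s x y)
        \<partial>outer_to_measure \<mu>) \<partial>outer_to_measure \<mu>)"

definition frac_norm ::
    "('a::metric_space set \<Rightarrow> ennreal) \<Rightarrow> real \<Rightarrow> 'a set \<Rightarrow> ('a \<Rightarrow> ereal) \<Rightarrow> ennreal" where
  "frac_norm \<mu> s \<Omega> u =
     (\<integral>\<^sup>+x\<in>\<Omega>. e2ennreal \<bar>u x\<bar> \<partial>outer_to_measure \<mu>) + frac_seminorm \<mu> s \<Omega> u"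

text \<open>
  Functions on \<open>\<Omega>\<close> are represented by functions on \<open>X\<close> whose values off \<open>\<Omega>\<close> are irrelevant.
\<close>

definition hom_frac_sobolev ::
    "('a::metric_space set \<Rightarrow> ennreal) \<Rightarrow> real \<Rightarrow> 'a set \<Rightarrow> ('a \<Rightarrow> ereal) set" where
  "hom_frac_sobolev \<mu> s \<Omega> =
     {u \<in> borel_measurable (restrict_space (outer_to_measure \<mu>) \<Omega>). frac_seminorm \<mu> s \<Omega> u < \<infinity>}"

definition frac_sobolev ::
    "('a::metric_space set \<Rightarrow> ennreal) \<Rightarrow> real \<Rightarrow> 'a set \<Rightarrow> ('a \<Rightarrow> ereal) set" where
  "frac_sobolev \<mu> s \<Omega> =
     {u \<in> borel_measurable (restrict_space (outer_to_measure \<mu>) \<Omega>). frac_norm \<mu> s \<Omega> u < \<infinity>}"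

definition frac_sobolev_zero ::
    "('a::metric_space set \<Rightarrow> ennreal) \<Rightarrow> real \<Rightarrow> 'a set \<Rightarrow> ('a \<Rightarrow> ereal) set" where
  "frac_sobolev_zero \<mu> s \<Omega> =
     {u \<in> frac_sobolev \<mu> s UNIV. AE x in outer_to_measure \<mu>. x \<notin> \<Omega> \<longrightarrow> u x = 0}"

text \<open>
  Integral of an extended real-valued function over \<open>A\<close>, as integral of the positive part minus
  integral of the negative part (\<open>e2ennreal\<close> maps negative numbers to \<open>0\<close>).
\<close>

definition ereal_set_integral :: "'a measure \<Rightarrow> 'a set \<Rightarrow> ('a \<Rightarrow> ereal) \<Rightarrow> ereal" where
  "ereal_set_integral M A f =
     enn2ereal (\<integral>\<^sup>+x\<in>A. e2ennreal (f x) \<partial>M) - enn2ereal (\<integral>\<^sup>+x\<in>A. e2ennreal (- f x) \<partial>M)"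

text \<open>
  The integrand of \<open>F(u,v)\<close>. Functions that are infinite on a part of the complement of \<open>\<Omega>\<close> of
  positive measure lead to \<open>\<infinity> - \<infinity>\<close> in the numerator, which is read as \<open>0\<close>. Then the
  integrand of \<open>F(u,u+\<eta>)\<close> is bounded in absolute value by the quotient of \<open>\<bar>\<eta> x - \<eta> y\<bar>\<close> and the
  weight (almost everywhere), so that \<open>F(u,u+\<eta>)\<close> is well defined and finite whenever \<open>\<eta>\<close> lies in
  \<open>frac_sobolev_zero\<close> and \<open>u\<close> is finite almost everywhere in \<open>\<Omega>\<close>.
\<close>

definition frac_integrand ::
    "('a::metric_space set \<Rightarrow> ennreal) \<Rightarrow> real \<Rightarrow> ('a \<Rightarrow> ereal) \<Rightarrow> ('a \<Rightarrow> ereal) \<Rightarrow> 'a \<Rightarrow> 'a \<Rightarrow> ereal"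
  where
  "frac_integrand \<mu> s u v x y =
     (if \<bar>u x - u y\<bar> = \<infinity> \<and> \<bar>v x - v y\<bar> = \<infinity> then 0 else \<bar>u x - u y\<bar> - \<bar>v x - v y\<bar>)
       / enn2ereal (frac_weight \<mu> s x y)"

definition frac_functional ::
    "('a::metric_space set \<Rightarrow> ennreal) \<Rightarrow> real \<Rightarrow> 'a set \<Rightarrow> ('a \<Rightarrow> ereal) \<Rightarrow> ('a \<Rightarrow> ereal) \<Rightarrow> ereal"
  where
  "frac_functional \<mu> s \<Omega> u v =
     ereal_set_integral (outer_to_measure \<mu>) \<Omega>
       (\<lambda>y. ereal_set_integral (outer_to_measure \<mu>) \<Omega> (\<lambda>x. frac_integrand \<mu> s u v x y))
     + 2 * ereal_set_integral (outer_to_measure \<mu>) \<Omega>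
       (\<lambda>y. ereal_set_integral (outer_to_measure \<mu>) (- \<Omega>) (\<lambda>x. frac_integrand \<mu> s u v x y))"

definition s_subminimizer ::
    "('a::metric_space set \<Rightarrow> ennreal) \<Rightarrow> real \<Rightarrow> 'a set \<Rightarrow> ('a \<Rightarrow> ereal) \<Rightarrow> bool" where
  "s_subminimizer \<mu> s \<Omega> u \<longleftrightarrow>
     u \<in> borel_measurable (outer_to_measure \<mu>) \<and> u \<in> hom_frac_sobolev \<mu> s \<Omega> \<and>
     (\<forall>\<eta>\<in>frac_sobolev_zero \<mu> s \<Omega>. (\<forall>x. \<eta> x \<le> 0) \<longrightarrow>
        frac_functional \<mu> s \<Omega> u (\<lambda>x. u x + \<eta> x) \<le> 0)"

definition s_superminimizer ::
    "('a::metric_space set \<Rightarrow> ennreal) \<Rightarrow> real \<Rightarrow> 'a set \<Rightarrow> ('a \<Rightarrow> ereal) \<Rightarrow> bool" where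
  "s_superminimizer \<mu> s \<Omega> u \<longleftrightarrow>
     u \<in> borel_measurable (outer_to_measure \<mu>) \<and> u \<in> hom_frac_sobolev \<mu> s \<Omega> \<and>
     (\<forall>\<eta>\<in>frac_sobolev_zero \<mu> s \<Omega>. (\<forall>x. \<eta> x \<ge> 0) \<longrightarrow>
        frac_functional \<mu> s \<Omega> u (\<lambda>x. u x + \<eta> x) \<le> 0)"

definition approx_lower_limit ::
    "('a::metric_space set \<Rightarrow> ennreal) \<Rightarrow> ('a \<Rightarrow> ereal) \<Rightarrow> 'a \<Rightarrow> ereal" where
  "approx_lower_limit \<mu> u x =
     Sup {ereal t |t::real.
       ((\<lambda>r. \<mu> {y \<in> ball x r. u y < ereal t} / \<mu> (ball x r)) \<longlongrightarrow> 0) (at_right 0)}"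

definition approx_upper_limit ::
    "('a::metric_space set \<Rightarrow> ennreal) \<Rightarrow> ('a \<Rightarrow> ereal) \<Rightarrow> 'a \<Rightarrow> ereal" where
  "approx_upper_limit \<mu> u x =
     Inf {ereal t |t::real.
       ((\<lambda>r. \<mu> {y \<in> ball x r. u y > ereal t} / \<mu> (ball x r)) \<longlongrightarrow> 0) (at_right 0)}"

definition lower_semicontinuous_on :: "'a::topological_space set \<Rightarrow> ('a \<Rightarrow> ereal) \<Rightarrow> bool" where
  "lower_semicontinuous_on S f \<longleftrightarrow> (\<forall>x\<in>S. \<forall>a<f x. \<forall>\<^sub>F y in at x within S. a < f y)"

definition upper_semicontinuous_on :: "'a::topological_space set \<Rightarrow> ('a \<Rightarrow> ereal) \<Rightarrow> bool" where
  "upper_semicontinuous_on S f \<longleftrightarrow> (\<forall>x\<in>S. \<forall>a>f x. \<forall>\<^sub>F y in at x within S. f y < a)"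

end

theory Submission
  imports Defs
begin

text \<open>
  Let \<open>u\<close> be a subminimizer, \<open>E = {u > t}\<close>, and let \<open>\<psi>\<close> be a Lipschitz cutoff that is \<open>1\<close> on the
  smaller and vanishes off the larger of two concentric balls in \<open>\<Omega>\<close>, with gap \<open>\<delta>\<close> between the
  radii. Testing with \<open>\<eta> = - min (u - t)\<^sup>+ (h \<psi>)\<close> and comparing the integrands pointwise bounds
  the interaction of \<open>E\<close> (in the small ball) with \<open>\<Omega> - E\<close> by the integral of
  \<open>\<bar>\<psi> x - \<psi> y\<bar>\<close> over the superlevel set, that is, by a multiple of \<open>\<delta>\<close> to the power \<open>-s\<close> times
  the measure of \<open>E\<close> in the large ball; the powers of \<open>h\<close> cancel, and \<open>h\<close> tends to \<open>0\<close>. Conversely,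
  if \<open>E\<close> fills at most half of each ball of radius \<open>\<rho>\<close> centred in the large ball, every point
  of \<open>E\<close> in the small ball interacts with \<open>\<Omega> - E\<close> at least as \<open>\<rho>\<close> to the power \<open>-s\<close>. So the
  measure of \<open>E\<close> drops by the factor \<open>(\<rho> / \<delta>)\<^sup>s\<close> (up to a constant), and a De Giorgi iteration
  over shrinking balls shows that \<open>E\<close> has measure zero in a ball as soon as its density in the
  concentric ball of twice the radius is small. Superminimizers are reduced to this by \<open>u \<mapsto> -u\<close>.
\<close>

section \<open>Doubling measures and the kernel\<close>

text \<open>A doubling constant may always be enlarged; with \<open>2 \<le> C\<close> the number
  \<open>1 / C\<close> can serve as the contraction ratio of the final iteration.\<close>

locale doubling_outer =
  fixes \<mu> :: "'a::polish_space set \<Rightarrow> ennreal" and s C :: real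
  assumes regular: "borel_regular_outer \<mu>"
    and s_pos: "0 < s" and s_less_1: "s < 1"
    and C_ge_2: "2 \<le> C"
    and ball_pos: "r > 0 \<Longrightarrow> 0 < \<mu> (ball x r)"
    and ball_finite: "r > 0 \<Longrightarrow> \<mu> (ball x r) < \<infinity>"
    and ball_double: "r > 0 \<Longrightarrow> \<mu> (ball x (2 * r)) \<le> ennreal C * \<mu> (ball x r)"
begin

abbreviation M :: "'a measure" where
  "M \<equiv> outer_to_measure \<mu>"

abbreviation V :: "'a \<Rightarrow> real \<Rightarrow> real" where
  "V x r \<equiv> measure M (ball x r)"

section \<open>The Caratheodory measure and volumes of balls\<close>

lemma outer: "outer_measure_space UNIV \<mu>"
  using regular by (simp add: borel_regular_outer_def)

lemma space_M [simp]: "space M = UNIV"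
  by (rule space_outer_to_measure[OF outer])

lemma borel_sets_M: "A \<in> sets borel \<Longrightarrow> A \<in> sets M"
  using regular by (auto simp: borel_regular_outer_def sets_outer_to_measure[OF outer])

lemma emeasure_M: "A \<in> sets M \<Longrightarrow> emeasure M A = \<mu> A"
  by (simp add: sets_outer_to_measure[OF outer] emeasure_outer_to_measure[OF outer])

lemma measurable_M_borel: "(\<lambda>x. x) \<in> measurable M borel"
  by (rule measurableI) (auto intro: borel_sets_M)

lemma measurable_into_borel: "f \<in> N \<rightarrow>\<^sub>M M \<Longrightarrow> f \<in> borel_measurable N"
  by (rule measurable_compose[OF _ measurable_M_borel])

lemma ball_sets [measurable, simp]: "ball x r \<in> sets M"
  by (rule borel_sets_M) simp

lemma open_sets: "open A \<Longrightarrow> A \<in> sets M"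
  by (rule borel_sets_M) simp

lemma emeasure_ball: "emeasure M (ball x r) = \<mu> (ball x r)"
  by (simp add: emeasure_M)

lemma emeasure_ball_less_top: "emeasure M (ball x r) < \<infinity>"
proof (cases "r > 0")
  case True
  then show ?thesis using ball_finite[of r x] by (simp add: emeasure_ball)
next
  case False
  then show ?thesis by (simp add: ball_empty)
qed

lemma emeasure_ball_eq: "emeasure M (ball x r) = ennreal (V x r)"
  using emeasure_ball_less_top[of x r] by (simp add: emeasure_eq_ennreal_measure)

lemma V_pos: "r > 0 \<Longrightarrow> V x r > 0"
  using ball_pos[of r x] by (simp add: emeasure_ball[symmetric] emeasure_ball_eq)

lemma V_double: "r > 0 \<Longrightarrow> V x (2 * r) \<le> C * V x r"
  using ball_double[of r x] C_ge_2
  by (simp add: emeasure_ball[symmetric] emeasure_ball_eq ennreal_mult[symmetric])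

lemma V_mono: "ball x r \<subseteq> ball y q \<Longrightarrow> V x r \<le> V y q"
  using emeasure_ball_less_top[of y q] by (intro measure_mono_fmeasurable) (auto simp: fmeasurable_def)

sublocale sigma_finite_measure M
proof
  fix x0 :: 'a
  show "\<exists>A. countable A \<and> A \<subseteq> sets M \<and> \<Union> A = space M \<and> (\<forall>a\<in>A. emeasure M a \<noteq> \<infinity>)"
  proof (intro exI[of _ "range (\<lambda>n::nat. ball undefined (real n))"] conjI ballI)
    show "\<Union> (range (\<lambda>n::nat. ball (undefined::'a) (real n))) = space M"
      by (auto simp: reals_Archimedean2)
  next
    fix a :: "'a set" assume "a \<in> range (\<lambda>n::nat. ball undefined (real n))"
    then show "emeasure M a \<noteq> \<infinity>" by (auto simp: emeasure_ball_eq)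
  qed auto
qed

section \<open>Measurability of the kernel\<close>

lemma emeasure_ball_pair_measurable [measurable]:
  "(\<lambda>z. \<mu> (ball_pair (fst z) (snd z))) \<in> borel_measurable (M \<Otimes>\<^sub>M M)"
proof -
  \<comment> \<open>The section of this open set over a pair of points is their
    \<open>ball_pair\<close>, so the volume of \<open>ball_pair\<close> is a section measure. Second
    countability of the space, through \<open>borel_prod\<close>, puts \<open>?Q\<close> into the
    product sigma-algebra.\<close>
  let ?Q = "{w :: ('a \<times> 'a) \<times> 'a. dist (fst (fst w)) (snd w) < dist (fst (fst w)) (snd (fst w)) \<or>
    dist (snd (fst w)) (snd w) < dist (fst (fst w)) (snd (fst w))}"
  have "open ?Q"
    by (intro open_Collect_disj open_Collect_less continuous_intros)
  then have "?Q \<in> sets borel" by simp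
  moreover have "(\<lambda>w. ((fst (fst w), snd (fst w)), snd w)) \<in> (M \<Otimes>\<^sub>M M) \<Otimes>\<^sub>M M \<rightarrow>\<^sub>M borel"
    unfolding borel_prod[symmetric] by (intro measurable_Pair measurable_into_borel) measurable
  ultimately have "?Q \<in> sets ((M \<Otimes>\<^sub>M M) \<Otimes>\<^sub>M M)"
    by (auto dest!: measurable_sets simp: space_pair_measure)
  from measurable_emeasure_Pair[OF this]
  have "(\<lambda>z. emeasure M (Pair z -` ?Q)) \<in> borel_measurable (M \<Otimes>\<^sub>M M)" .
  moreover have "emeasure M (Pair z -` ?Q) = \<mu> (ball_pair (fst z) (snd z))" for z
  proof -
    have "Pair z -` ?Q = ball_pair (fst z) (snd z)"
      by (auto simp: ball_pair_def)
    then show ?thesis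
      by (simp add: emeasure_M ball_pair_def)
  qed
  ultimately show ?thesis by simp
qed

lemma dist_measurable [measurable]:
  "(\<lambda>z. dist (fst z) (snd z)) \<in> borel_measurable (M \<Otimes>\<^sub>M M)"
proof -
  have "(\<lambda>w. (fst w, snd w)) \<in> M \<Otimes>\<^sub>M M \<rightarrow>\<^sub>M (borel :: ('a \<times> 'a) measure)"
    unfolding borel_prod[symmetric] by (intro measurable_Pair measurable_into_borel) measurable
  moreover have "(\<lambda>z::'a\<times>'a. dist (fst z) (snd z)) \<in> borel_measurable borel"
    by (intro borel_measurable_continuous_onI continuous_intros)
  ultimately show ?thesis by (simp add: measurable_compose)
qed

lemma frac_weight_measurable [measurable]:
  "(\<lambda>z. frac_weight \<mu> s (fst z) (snd z)) \<in> borel_measurable (M \<Otimes>\<^sub>M M)"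
  unfolding frac_weight_def by measurable

lemma frac_weight_measurable_compose [measurable (raw)]:
  assumes [measurable]: "f \<in> N \<rightarrow>\<^sub>M M" "g \<in> N \<rightarrow>\<^sub>M M"
  shows "(\<lambda>z. frac_weight \<mu> s (f z) (g z)) \<in> borel_measurable N"
proof -
  have "(\<lambda>z. (f z, g z)) \<in> N \<rightarrow>\<^sub>M M \<Otimes>\<^sub>M M" by measurable
  from measurable_compose[OF this frac_weight_measurable] show ?thesis by simp
qed

lemma dist_measurable_compose [measurable (raw)]:
  assumes [measurable]: "f \<in> N \<rightarrow>\<^sub>M M" "g \<in> N \<rightarrow>\<^sub>M M"
  shows "(\<lambda>z. dist (f z) (g z)) \<in> borel_measurable N"
proof -
  have "(\<lambda>z. (f z, g z)) \<in> N \<rightarrow>\<^sub>M M \<Otimes>\<^sub>M M" by measurable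
  from measurable_compose[OF this dist_measurable] show ?thesis by simp
qed

section \<open>Symmetry, size and tails of the kernel\<close>

lemma frac_weight_commute: "frac_weight \<mu> s x y = frac_weight \<mu> s y x"
  by (simp add: frac_weight_def ball_pair_def dist_commute Un_commute)

lemma ball_pair_sets [simp]: "ball_pair x y \<in> sets M"
  by (simp add: ball_pair_def)

text \<open>Both bounds for the weight use volumes of balls about \<open>y\<close> only, so that
  \<open>x\<close> can be integrated out with \<open>y\<close> fixed. Here
  \<open>ball_pair x y\<close> contains the ball about \<open>y\<close> of radius
  \<open>dist x y\<close>.\<close>

lemma frac_weight_ge:
  assumes "0 < r" "r \<le> dist x y"
  shows "ennreal (V y r * r powr s) \<le> frac_weight \<mu> s x y"
proof -
  have "ennreal (V y r) \<le> \<mu> (ball_pair x y)"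
    unfolding emeasure_ball_eq[symmetric] emeasure_M[OF ball_pair_sets, symmetric]
    using assms by (intro emeasure_mono) (auto simp: ball_pair_def)
  moreover have "r powr s \<le> dist x y powr s"
    using assms s_pos by (intro powr_mono2) auto
  ultimately show ?thesis
    unfolding frac_weight_def by (simp add: ennreal_mult mult_mono ennreal_leI)
qed

text \<open>By the triangle inequality, a point closer than \<open>dist x y\<close> to
  \<open>x\<close> is within twice that distance of \<open>y\<close>.\<close>

lemma frac_weight_le:
  assumes "dist x y \<le> r"
  shows "frac_weight \<mu> s x y \<le> ennreal (V y (2 * r) * r powr s)"
proof -
  have "ball_pair x y \<subseteq> ball y (2 * r)"
  proof
    fix z assume "z \<in> ball_pair x y"
    then have "dist x z < dist x y \<or> dist y z < dist x y"
      by (auto simp: ball_pair_def)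
    moreover have "dist y z \<le> dist x y + dist x z"
      by (metis dist_commute dist_triangle)
    ultimately show "z \<in> ball y (2 * r)" using assms zero_le_dist[of y z] unfolding mem_ball by linarith
  qed
  then have "\<mu> (ball_pair x y) \<le> ennreal (V y (2 * r))"
    unfolding emeasure_ball_eq[symmetric] emeasure_M[OF ball_pair_sets, symmetric]
    by (intro emeasure_mono) auto
  moreover have "dist x y powr s \<le> r powr s"
    using assms s_pos by (intro powr_mono2) auto
  ultimately show ?thesis
    unfolding frac_weight_def by (simp add: ennreal_mult mult_mono ennreal_leI)
qed

text \<open>Off the diagonal this turns quotients in \<open>ennreal\<close> and \<open>ereal\<close>
  into real ones.\<close>

lemma frac_weight_real:
  assumes "x \<noteq> y"
  obtains k where "k > 0" "frac_weight \<mu> s x y = ennreal k"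
proof -
  have "frac_weight \<mu> s x y < \<infinity>"
    using frac_weight_le[of x y "dist x y"] by (simp add: order_le_less_trans)
  moreover have "0 < V y (dist x y) * dist x y powr s"
    using assms V_pos[of "dist x y" y] by simp
  then have "0 < frac_weight \<mu> s x y"
    using frac_weight_ge[of "dist x y" x y] assms
    by (metis ennreal_less_zero_iff order.refl order_less_le_trans zero_less_dist_iff)
  ultimately show ?thesis
    using that[of "enn2real (frac_weight \<mu> s x y)"] by (simp add: enn2real_positive_iff)
qed

lemma frac_weight_diag [simp]: "frac_weight \<mu> s x x = 0"
  by (simp add: frac_weight_def ball_pair_def)

text \<open>On the annulus the weight is at least \<open>V y r * r powr s\<close>, while doubling
  bounds the volume of the annulus by \<open>C * V y r\<close>. The volumes cancel, so the bound
  does not depend on \<open>y\<close>.\<close>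

lemma annulus_integral:
  assumes r: "0 < r"
  shows "(\<integral>\<^sup>+x. indicator (ball y (2 * r) - ball y r) x / frac_weight \<mu> s x y \<partial>M)
    \<le> ennreal (C * r powr - s)"
proof -
  have V: "V y r > 0" using r by (rule V_pos)
  have "(\<integral>\<^sup>+x. indicator (ball y (2 * r) - ball y r) x / frac_weight \<mu> s x y \<partial>M)
    \<le> (\<integral>\<^sup>+x. ennreal (1 / (V y r * r powr s)) * indicator (ball y (2 * r)) x \<partial>M)"
  proof (intro nn_integral_mono)
    fix x
    show "indicator (ball y (2 * r) - ball y r) x / frac_weight \<mu> s x y
      \<le> ennreal (1 / (V y r * r powr s)) * indicator (ball y (2 * r)) x"
    proof (cases "x \<in> ball y (2 * r) - ball y r")
      case True
      then have d: "r \<le> dist x y" by (auto simp: dist_commute)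
      then have "x \<noteq> y" using r by auto
      then obtain k where k: "k > 0" "frac_weight \<mu> s x y = ennreal k"
        by (rule frac_weight_real)
      have "V y r * r powr s \<le> k"
        using frac_weight_ge[OF r d] k by simp
      then have "1 / k \<le> 1 / (V y r * r powr s)"
        using V r k by (intro divide_left_mono) auto
      moreover have "1 / ennreal k = ennreal (1 / k)"
        using divide_ennreal[of 1 k] k by simp
      ultimately show ?thesis
        using True k by (simp add: ennreal_leI)
    qed simp
  qed
  also have "\<dots> = ennreal (1 / (V y r * r powr s)) * ennreal (V y (2 * r))"
    by (simp add: emeasure_ball_eq nn_integral_cmult)
  also have "\<dots> = ennreal (V y (2 * r) / (V y r * r powr s))"
    using V r by (simp add: ennreal_mult[symmetric])
  also have "\<dots> \<le> ennreal (C * V y r / (V y r * r powr s))"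
    using V r V_double[OF r] by (intro ennreal_leI divide_right_mono) auto
  also have "\<dots> = ennreal (C * r powr - s)"
    using V by (simp add: powr_minus field_simps)
  finally show ?thesis .
qed

text \<open>The summands come from geometric series over dyadic annuli: ratio
  \<open>2 powr s / 2\<close> inside radius \<delta>, convergent because \<open>s < 1\<close>, and
  ratio \<open>2 powr - s\<close> outside, convergent because \<open>0 < s\<close>. The numerator
  \<open>2 powr s\<close> appears because the outermost inner annulus has inner radius \<delta> /
  2.\<close>

definition tail_const :: real where
  "tail_const = C * (2 powr s / (1 - 2 powr s / 2) + 1 / (1 - 2 powr - s))"

lemma powr_ratios: "2 powr s / 2 < 1" "2 powr - s < (1::real)"
  using powr_less_mono[OF s_less_1, of 2] powr_less_mono[of "-s" 0 "2::real"] s_pos by auto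

lemma tail_const_pos: "0 < tail_const"
  unfolding tail_const_def using C_ge_2 powr_ratios
  by (intro mult_pos_pos add_pos_pos divide_pos_pos) auto

text \<open>Off the diagonal \<open>x\<close> lies in a dyadic annulus about \<open>y\<close>, and
  the term of that annulus alone dominates. Inside radius \<delta> the Lipschitz factor supplies the
  weights \<open>(1 / 2) ^ n\<close>; outside it is bounded by 1.\<close>

lemma min_dist_quotient_le_annuli:
  assumes "0 < \<delta>"
  shows "ennreal (min 1 (dist x y / \<delta>)) / frac_weight \<mu> s x y
    \<le> (\<Sum>n. ennreal ((1 / 2) ^ n) *
          (indicator (ball y (2 * (\<delta> / 2 ^ Suc n)) - ball y (\<delta> / 2 ^ Suc n)) x / frac_weight \<mu> s x y))
      + (\<Sum>n. indicator (ball y (2 * (\<delta> * 2 ^ n)) - ball y (\<delta> * 2 ^ n)) x / frac_weight \<mu> s x y)"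
    (is "?L \<le> (\<Sum>n. ?f n) + (\<Sum>n. ?g n)")
proof -
  consider "x = y" | "0 < dist x y" "dist x y < \<delta>" | "\<delta> \<le> dist x y"
    by fastforce
  then show ?thesis
  proof cases
    case 1
    then show ?thesis by simp
  next
    case 2
    \<comment> \<open>The least such \<open>n\<close> selects the annulus: minimality yields
      \<open>dist x y < \<delta> / 2 ^ n\<close>, which for \<open>n = 0\<close> is the assumption
      of the case.\<close>
    define P where "P n \<longleftrightarrow> \<delta> / 2 ^ Suc n \<le> dist x y" for n
    obtain k where "(1/2) ^ k < dist x y / \<delta>"
      using real_arch_pow_inv[of "dist x y / \<delta>" "1/2"] 2 assms by auto
    then have "\<delta> / 2 ^ k \<le> dist x y" using assms by (simp add: field_simps)
    moreover have "\<delta> / 2 ^ Suc k \<le> \<delta> / 2 ^ k"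
      using assms by (intro divide_left_mono) auto
    ultimately have "P k" unfolding P_def by linarith
    define n where "n = (LEAST n. P n)"
    have "P n" unfolding n_def by (rule LeastI[of P, OF \<open>P k\<close>])
    moreover have "dist x y < \<delta> / 2 ^ n"
    proof (cases n)
      case (Suc m)
      then have "\<not> P m" using not_less_Least[of m P] n_def by auto
      then show ?thesis using Suc by (simp add: P_def)
    qed (use 2 in simp)
    moreover from this have "dist x y / \<delta> \<le> (1 / 2) ^ n"
      using assms by (simp add: field_simps)
    ultimately have "x \<in> ball y (2 * (\<delta> / 2 ^ Suc n)) - ball y (\<delta> / 2 ^ Suc n)"
      and "min 1 (dist x y / \<delta>) \<le> (1 / 2) ^ n"
      by (auto simp: P_def dist_commute intro: min.coboundedI2)
    then have "?L \<le> ?f n"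
      by (simp add: ennreal_times_divide divide_right_mono_ennreal ennreal_leI)
    also have "\<dots> \<le> (\<Sum>n. ?f n)"
      using sum_le_suminf[of ?f "{n}"] by simp
    finally show ?thesis by (simp add: add_increasing2)
  next
    case 3
    define P where "P n \<longleftrightarrow> dist x y < \<delta> * 2 ^ Suc n" for n
    obtain k where "dist x y / \<delta> < 2 ^ k"
      using real_arch_pow[of 2 "dist x y / \<delta>"] by auto
    then have "dist x y < \<delta> * 2 ^ k" using assms by (simp add: field_simps)
    moreover have "\<delta> * 2 ^ k \<le> \<delta> * 2 ^ Suc k"
      using assms by (intro mult_left_mono) auto
    ultimately have "P k" unfolding P_def by linarith
    define n where "n = (LEAST n. P n)"
    have "P n" unfolding n_def by (rule LeastI[of P, OF \<open>P k\<close>])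
    moreover have "\<delta> * 2 ^ n \<le> dist x y"
    proof (cases n)
      case (Suc m)
      then have "\<not> P m" using not_less_Least[of m P] n_def by auto
      then show ?thesis using Suc by (simp add: P_def)
    qed (use 3 in simp)
    ultimately have "x \<in> ball y (2 * (\<delta> * 2 ^ n)) - ball y (\<delta> * 2 ^ n)"
      by (auto simp: P_def dist_commute mult.commute mult.left_commute)
    then have "?L \<le> ?g n"
      by (simp add: divide_right_mono_ennreal ennreal_leI)
    also have "\<dots> \<le> (\<Sum>n. ?g n)"
      using sum_le_suminf[of ?g "{n}"] by simp
    finally show ?thesis by (simp add: add_increasing)
  qed
qed

text \<open>The annulus bounds are summed. Both geometric series carry the factor
  \<open>\<delta> powr - s\<close>, and the result is uniform in \<open>y\<close>.\<close>

lemma tail_integral: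
  assumes \<delta>: "0 < \<delta>"
  shows "(\<integral>\<^sup>+x. ennreal (min 1 (dist x y / \<delta>)) / frac_weight \<mu> s x y \<partial>M)
    \<le> ennreal (tail_const * \<delta> powr - s)"
proof -
  let ?A = "\<lambda>r. ball y (2 * r) - ball y r"
  let ?I = "\<lambda>r. \<integral>\<^sup>+x. indicator (?A r) x / frac_weight \<mu> s x y \<partial>M"
  have [measurable]: "?A r \<in> sets M" for r by auto
  have near: "(\<Sum>n. ennreal ((1 / 2) ^ n) * ?I (\<delta> / 2 ^ Suc n))
      \<le> ennreal (C * 2 powr s * \<delta> powr - s * (1 / (1 - 2 powr s / 2)))"
  proof -
    have "ennreal ((1 / 2) ^ n) * ?I (\<delta> / 2 ^ Suc n)
      \<le> ennreal (C * 2 powr s * \<delta> powr - s * (2 powr s / 2) ^ n)" for n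
    proof -
      have "ennreal ((1 / 2) ^ n) * ?I (\<delta> / 2 ^ Suc n)
        \<le> ennreal ((1 / 2) ^ n) * ennreal (C * (\<delta> / 2 ^ Suc n) powr - s)"
        using \<delta> by (intro mult_left_mono annulus_integral) auto
      also have "\<dots> = ennreal ((1 / 2) ^ n * (C * (\<delta> / 2 ^ Suc n) powr - s))"
        using C_ge_2 by (intro ennreal_mult[symmetric]) auto
      also have "(\<delta> / 2 ^ Suc n) powr - s = \<delta> powr - s * (2 powr s * (2 powr s) ^ n)"
      proof -
        have "(2 ^ n) powr s = (2 powr s) ^ n"
          by (simp add: powr_realpow[symmetric] powr_powr mult.commute)
        then show ?thesis
          using \<delta> by (simp add: powr_divide powr_minus powr_mult field_simps)
      qed
      finally show ?thesis by (simp add: power_divide field_simps)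
    qed
    then have "(\<Sum>n. ennreal ((1 / 2) ^ n) * ?I (\<delta> / 2 ^ Suc n))
      \<le> (\<Sum>n. ennreal (C * 2 powr s * \<delta> powr - s * (2 powr s / 2) ^ n))"
      by (intro suminf_le) auto
    also have "\<dots> = ennreal (C * 2 powr s * \<delta> powr - s * (1 / (1 - 2 powr s / 2)))"
      using C_ge_2 powr_ratios
      by (intro suminf_ennreal_eq sums_mult geometric_sums) auto
    finally show ?thesis .
  qed
  have far: "(\<Sum>n. ?I (\<delta> * 2 ^ n)) \<le> ennreal (C * \<delta> powr - s * (1 / (1 - 2 powr - s)))"
  proof -
    have "?I (\<delta> * 2 ^ n) \<le> ennreal (C * \<delta> powr - s * (2 powr - s) ^ n)" for n
    proof -
      have "?I (\<delta> * 2 ^ n) \<le> ennreal (C * (\<delta> * 2 ^ n) powr - s)"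
        using \<delta> by (intro annulus_integral) auto
      also have "(\<delta> * 2 ^ n) powr - s = \<delta> powr - s * (2 powr - s) ^ n"
        using \<delta> by (simp add: powr_mult powr_power powr_realpow[symmetric] powr_powr mult.commute)
      finally show ?thesis by (simp add: mult.assoc)
    qed
    then have "(\<Sum>n. ?I (\<delta> * 2 ^ n)) \<le> (\<Sum>n. ennreal (C * \<delta> powr - s * (2 powr - s) ^ n))"
      by (intro suminf_le) auto
    also have "\<dots> = ennreal (C * \<delta> powr - s * (1 / (1 - 2 powr - s)))"
      using C_ge_2 powr_ratios
      by (intro suminf_ennreal_eq sums_mult geometric_sums) auto
    finally show ?thesis .
  qed
  have "(\<integral>\<^sup>+x. ennreal (min 1 (dist x y / \<delta>)) / frac_weight \<mu> s x y \<partial>M)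
    \<le> (\<integral>\<^sup>+x. (\<Sum>n. ennreal ((1 / 2) ^ n) * (indicator (?A (\<delta> / 2 ^ Suc n)) x / frac_weight \<mu> s x y))
      + (\<Sum>n. indicator (?A (\<delta> * 2 ^ n)) x / frac_weight \<mu> s x y) \<partial>M)"
    by (intro nn_integral_mono min_dist_quotient_le_annuli \<delta>)
  also have "\<dots> = (\<Sum>n. ennreal ((1 / 2) ^ n) * ?I (\<delta> / 2 ^ Suc n)) + (\<Sum>n. ?I (\<delta> * 2 ^ n))"
  proof -
    define F where "F r x = indicator (?A r) x / frac_weight \<mu> s x y" for r x
    have [measurable]: "F r \<in> borel_measurable M" for r
      unfolding F_def by measurable
    show ?thesis
      unfolding F_def[symmetric] by (simp add: nn_integral_add nn_integral_suminf nn_integral_cmult)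
  qed
  also have "\<dots> \<le> ennreal (C * 2 powr s * \<delta> powr - s * (1 / (1 - 2 powr s / 2)))
      + ennreal (C * \<delta> powr - s * (1 / (1 - 2 powr - s)))"
    by (intro add_mono near far)
  also have "\<dots> = ennreal (tail_const * \<delta> powr - s)"
    using C_ge_2 powr_ratios
    by (subst ennreal_plus[symmetric]) (auto simp: tail_const_def algebra_simps)
  finally show ?thesis .
qed

end

section \<open>Lower bounds for extended integrals\<close>

text \<open>The difference is rewritten without subtraction, in terms of positive and negative
  parts. In this form it can be integrated term by term even if the integrals are infinite.\<close>

lemma e2ennreal_split_le:
  assumes "n \<noteq> \<infinity>" "enn2ereal p - enn2ereal n \<le> f"
  shows "e2ennreal (- f) + p \<le> e2ennreal f + n"
proof (cases n)
  case n: (real b)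
  show ?thesis
  proof (cases f)
    case f: (real r)
    show ?thesis
    proof (cases p)
      case (real a)
      then have "a - b \<le> r" using assms n f by simp
      then show ?thesis
        using real n f by (cases "r \<ge> 0") (auto simp: ennreal_neg ennreal_plus[symmetric] simp del: ennreal_plus intro!: ennreal_leI)
    qed (use assms n f in \<open>simp\<close>)
  next
    case PInf
    then show ?thesis by simp
  next
    case MInf
    then show ?thesis using assms n by (cases p) (auto simp:)
  qed
qed (use assms in simp)

text \<open>The way back from the subtraction-free form. If \<open>a\<close> is finite, so are all
  other terms; if \<open>a\<close> is infinite, the right side is infinite, also for infinite
  \<open>b\<close>, because \<infinity> - \<infinity> = \<infinity> in \<open>ereal\<close>.\<close>

lemma enn2ereal_diff_le:
  assumes "b + p \<le> a + n" "n \<noteq> \<infinity>"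
  shows "enn2ereal p - enn2ereal n \<le> enn2ereal a - enn2ereal b"
proof (cases a)
  case a: (real a1)
  obtain n1 where n: "n = ennreal n1" "0 \<le> n1" using assms by (cases n) auto
  have "b + p \<noteq> top" using assms a n by (auto simp: top_unique ennreal_plus[symmetric] simp del: ennreal_plus)
  then obtain b1 p1 where bp: "b = ennreal b1" "0 \<le> b1" "p = ennreal p1" "0 \<le> p1"
    by (cases b; cases p) auto
  then show ?thesis
    using assms a n by (simp add: enn2ereal_ennreal ennreal_plus[symmetric] del: ennreal_plus)
next
  case top
  then show ?thesis by simp
qed

text \<open>A pointwise lower bound "gain \<open>p\<close> minus loss \<open>n\<close>" passes to
  the extended integral as soon as the loss is integrable; \<open>f\<close> itself may have an
  infinite integral.\<close>

lemma ereal_set_integral_ge: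
  assumes [measurable]: "f \<in> borel_measurable N" "p \<in> borel_measurable N" "n \<in> borel_measurable N" "A \<in> sets N"
    and le: "AE x in N. x \<in> A \<longrightarrow> enn2ereal (p x) - enn2ereal (n x) \<le> f x"
    and fin: "(\<integral>\<^sup>+x\<in>A. n x \<partial>N) < \<infinity>"
  shows "enn2ereal (\<integral>\<^sup>+x\<in>A. p x \<partial>N) - enn2ereal (\<integral>\<^sup>+x\<in>A. n x \<partial>N) \<le> ereal_set_integral N A f"
proof -
  have "AE x in N. n x * indicator A x \<noteq> \<infinity>"
    using fin by (intro nn_integral_PInf_AE) auto
  with le have "AE x in N. e2ennreal (- f x) * indicator A x + p x * indicator A x
      \<le> e2ennreal (f x) * indicator A x + n x * indicator A x"
  proof eventually_elim
    case (elim x)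
    then show ?case using e2ennreal_split_le[of "n x" "p x" "f x"] by (cases "x \<in> A") auto
  qed
  then have "(\<integral>\<^sup>+x. e2ennreal (- f x) * indicator A x + p x * indicator A x \<partial>N)
      \<le> (\<integral>\<^sup>+x. e2ennreal (f x) * indicator A x + n x * indicator A x \<partial>N)"
    by (rule nn_integral_mono_AE)
  then have "(\<integral>\<^sup>+x\<in>A. e2ennreal (- f x) \<partial>N) + (\<integral>\<^sup>+x\<in>A. p x \<partial>N)
      \<le> (\<integral>\<^sup>+x\<in>A. e2ennreal (f x) \<partial>N) + (\<integral>\<^sup>+x\<in>A. n x \<partial>N)"
    by (simp add: nn_integral_add)
  then show ?thesis
    unfolding ereal_set_integral_def using fin by (intro enn2ereal_diff_le) auto
qed

section \<open>Cutoff functions\<close>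

definition cutoff :: "'a::metric_space \<Rightarrow> real \<Rightarrow> real \<Rightarrow> 'a \<Rightarrow> real" where
  "cutoff x0 r \<delta> x = max 0 (min 1 ((r - dist x0 x) / \<delta>))"

lemma cutoff_nonneg: "0 \<le> cutoff x0 r \<delta> x"
  and cutoff_le_1: "cutoff x0 r \<delta> x \<le> 1"
  by (auto simp: cutoff_def)

lemma cutoff_eq_0: "0 < \<delta> \<Longrightarrow> x \<notin> ball x0 r \<Longrightarrow> cutoff x0 r \<delta> x = 0"
  by (auto simp: cutoff_def max_def min_def field_simps)

lemma cutoff_eq_1: "0 < \<delta> \<Longrightarrow> x \<in> ball x0 (r - \<delta>) \<Longrightarrow> cutoff x0 r \<delta> x = 1"
  by (auto simp: cutoff_def max_def min_def field_simps)

text \<open>Clamping to the unit interval does not increase distances, and the distance to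
  \<open>x0\<close> is 1-Lipschitz.\<close>

lemma cutoff_lipschitz:
  assumes "0 < \<delta>"
  shows "\<bar>cutoff x0 r \<delta> x - cutoff x0 r \<delta> y\<bar> \<le> dist x y / \<delta>"
proof -
  have "\<bar>cutoff x0 r \<delta> x - cutoff x0 r \<delta> y\<bar> \<le> \<bar>(r - dist x0 x) / \<delta> - (r - dist x0 y) / \<delta>\<bar>"
    unfolding cutoff_def by linarith
  also have "\<dots> = \<bar>dist x0 y - dist x0 x\<bar> / \<delta>"
    using assms by (simp add: diff_divide_distrib[symmetric])
  also have "\<dots> \<le> dist x y / \<delta>"
    using assms abs_dist_diff_le[of y x0 x] by (intro divide_right_mono) (auto simp: dist_commute)
  finally show ?thesis .
qed

lemma cutoff_diff_le:
  assumes "0 < \<delta>"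
  shows "\<bar>cutoff x0 r \<delta> x - cutoff x0 r \<delta> y\<bar> \<le> min 1 (dist x y / \<delta>)"
  using cutoff_lipschitz[OF assms, of x0 r x y] cutoff_nonneg[of x0 r \<delta> x] cutoff_le_1[of x0 r \<delta> x]
    cutoff_nonneg[of x0 r \<delta> y] cutoff_le_1[of x0 r \<delta> y] by (auto simp: abs_le_iff)

lemma continuous_on_cutoff: "0 < \<delta> \<Longrightarrow> continuous_on A (cutoff x0 r \<delta>)"
  unfolding cutoff_def[abs_def] by (intro continuous_intros) auto

context doubling_outer begin

lemma cutoff_measurable: "0 < \<delta> \<Longrightarrow> cutoff x0 r \<delta> \<in> borel_measurable M"
  by (rule measurable_compose[OF measurable_M_borel borel_measurable_continuous_onI[OF continuous_on_cutoff]])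

text \<open>A pair with both points off the ball contributes nothing. Any other pair in
  \<open>D\<close> is charged to a member in \<open>D \<inter> ball x0 r\<close>, and the tail bound
  at that point integrates out the other variable. The factor 2 accounts for the two variables. It
  matters that the measure of \<open>D\<close> in the ball appears, not that of the whole
  ball.\<close>

lemma cutoff_integral:
  assumes \<delta>: "0 < \<delta>" and [measurable]: "D \<in> sets M"
  shows "(\<integral>\<^sup>+y\<in>D. (\<integral>\<^sup>+x\<in>D. (ennreal \<bar>cutoff x0 r \<delta> x - cutoff x0 r \<delta> y\<bar> / frac_weight \<mu> s x y) \<partial>M) \<partial>M)
    \<le> ennreal (2 * tail_const * \<delta> powr - s) * emeasure M (D \<inter> ball x0 r)"
proof -
  interpret pair_sigma_finite M M ..
  define k where "k x y = ennreal (min 1 (dist x y / \<delta>)) / frac_weight \<mu> s x y" for x y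
  define B where "B = D \<inter> ball x0 r"
  define T where "T = ennreal (tail_const * \<delta> powr - s)"
  have [measurable]: "B \<in> sets M" by (simp add: B_def)
  have k_meas: "(\<lambda>z. k (fst z) (snd z)) \<in> borel_measurable (M \<Otimes>\<^sub>M M)"
    unfolding k_def by measurable
  have [measurable (raw)]: "(\<lambda>z. k (f z) (g z)) \<in> borel_measurable N"
    if [measurable]: "f \<in> N \<rightarrow>\<^sub>M M" "g \<in> N \<rightarrow>\<^sub>M M" for f g and N :: "'b measure"
  proof -
    have "(\<lambda>z. (f z, g z)) \<in> N \<rightarrow>\<^sub>M M \<Otimes>\<^sub>M M" by measurable
    from measurable_compose[OF this k_meas] show ?thesis by simp
  qed
  have k1: "(\<integral>\<^sup>+x. k x y \<partial>M) \<le> T" for y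
    using tail_integral[OF \<delta>] by (simp add: k_def T_def)
  have k2: "(\<integral>\<^sup>+y. k x y \<partial>M) \<le> T" for x
    using k1[of x] by (simp add: k_def dist_commute frac_weight_commute)
  have le: "(ennreal \<bar>cutoff x0 r \<delta> x - cutoff x0 r \<delta> y\<bar> / frac_weight \<mu> s x y) * indicator D x * indicator D y
    \<le> k x y * indicator B y + k x y * indicator B x" for x y
  proof -
    have "\<bar>cutoff x0 r \<delta> x - cutoff x0 r \<delta> y\<bar> \<le> min 1 (dist x y / \<delta>)"
      using \<delta> by (rule cutoff_diff_le)
    then have *: "ennreal \<bar>cutoff x0 r \<delta> x - cutoff x0 r \<delta> y\<bar> / frac_weight \<mu> s x y \<le> k x y"
      unfolding k_def by (intro divide_right_mono_ennreal ennreal_leI)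
    consider "x \<notin> D \<or> y \<notin> D" | "x \<in> D" "y \<in> D" "x \<in> B \<or> y \<in> B" | "x \<notin> ball x0 r" "y \<notin> ball x0 r"
      by (auto simp: B_def)
    then show ?thesis
    proof cases
      case 2
      from 2(3) have "k x y \<le> k x y * indicator B y + k x y * indicator B x"
        using add_increasing[of "k x y * indicator B y" "k x y" "k x y"] 
          add_increasing2[of "k x y * indicator B x" "k x y" "k x y"] by auto
      from order_trans[OF * this] show ?thesis using 2 by simp
    next
      case 3
      then show ?thesis using cutoff_eq_0[OF \<delta> 3(1)] cutoff_eq_0[OF \<delta> 3(2)] by simp
    qed auto
  qed
  have "(\<integral>\<^sup>+y\<in>D. (\<integral>\<^sup>+x\<in>D. (ennreal \<bar>cutoff x0 r \<delta> x - cutoff x0 r \<delta> y\<bar> / frac_weight \<mu> s x y) \<partial>M) \<partial>M)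
    = (\<integral>\<^sup>+y. (\<integral>\<^sup>+x. (ennreal \<bar>cutoff x0 r \<delta> x - cutoff x0 r \<delta> y\<bar> / frac_weight \<mu> s x y) * indicator D x * indicator D y \<partial>M) \<partial>M)"
    using cutoff_measurable[OF \<delta>, of x0 r, measurable] by (simp add: nn_integral_multc)
  also have "\<dots> \<le> (\<integral>\<^sup>+y. (\<integral>\<^sup>+x. k x y * indicator B y + k x y * indicator B x \<partial>M) \<partial>M)"
    by (intro nn_integral_mono le)
  also have "\<dots> = (\<integral>\<^sup>+y. (\<integral>\<^sup>+x. k x y * indicator B y \<partial>M) \<partial>M) + (\<integral>\<^sup>+y. (\<integral>\<^sup>+x. k x y * indicator B x \<partial>M) \<partial>M)"
    by (simp add: nn_integral_add)
  also have "(\<integral>\<^sup>+y. (\<integral>\<^sup>+x. k x y * indicator B x \<partial>M) \<partial>M) = (\<integral>\<^sup>+x. (\<integral>\<^sup>+y. k x y * indicator B x \<partial>M) \<partial>M)"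
    by (rule Fubini') measurable
  also have "(\<integral>\<^sup>+y. (\<integral>\<^sup>+x. k x y * indicator B y \<partial>M) \<partial>M) \<le> (\<integral>\<^sup>+y. T * indicator B y \<partial>M)"
    by (intro nn_integral_mono) (simp add: nn_integral_multc mult_right_mono k1)
  also have "(\<integral>\<^sup>+x. (\<integral>\<^sup>+y. k x y * indicator B x \<partial>M) \<partial>M) \<le> (\<integral>\<^sup>+x. T * indicator B x \<partial>M)"
    by (intro nn_integral_mono) (simp add: nn_integral_multc mult_right_mono k2)
  also have "(\<integral>\<^sup>+y. T * indicator B y \<partial>M) + (\<integral>\<^sup>+y. T * indicator B y \<partial>M) = (T + T) * emeasure M B"
    by (simp add: nn_integral_cmult distrib_right)
  also have "T + T = ennreal (2 * tail_const * \<delta> powr - s)"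
    unfolding T_def using tail_const_pos by (subst ennreal_plus[symmetric]) auto
  finally show ?thesis by (simp add: B_def)
qed

text \<open>The tail bound with one point fixed, to be applied with \<open>- \<Omega>\<close> as
  \<open>A\<close>.\<close>

lemma cutoff_integral_outside:
  assumes \<delta>: "0 < \<delta>" and y: "y \<in> ball x0 r" and [measurable]: "A \<in> sets M"
  shows "(\<integral>\<^sup>+x\<in>A. (ennreal \<bar>cutoff x0 r \<delta> x - cutoff x0 r \<delta> y\<bar> / frac_weight \<mu> s x y) \<partial>M)
    \<le> ennreal (tail_const * \<delta> powr - s)"
proof -
  have "(\<integral>\<^sup>+x\<in>A. (ennreal \<bar>cutoff x0 r \<delta> x - cutoff x0 r \<delta> y\<bar> / frac_weight \<mu> s x y) \<partial>M)
    \<le> (\<integral>\<^sup>+x. ennreal (min 1 (dist x y / \<delta>)) / frac_weight \<mu> s x y \<partial>M)"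
  proof (intro nn_integral_mono)
    fix x
    have "\<bar>cutoff x0 r \<delta> x - cutoff x0 r \<delta> y\<bar> \<le> min 1 (dist x y / \<delta>)"
      using \<delta> by (rule cutoff_diff_le)
    then show "ennreal \<bar>cutoff x0 r \<delta> x - cutoff x0 r \<delta> y\<bar> / frac_weight \<mu> s x y * indicator A x
      \<le> ennreal (min 1 (dist x y / \<delta>)) / frac_weight \<mu> s x y"
      by (auto simp: indicator_def intro!: divide_right_mono_ennreal ennreal_leI)
  qed
  also note tail_integral[OF \<delta>]
  finally show ?thesis .
qed

end

section \<open>Energy estimate for superlevel sets\<close>

text \<open>The truncation of the positive part of \<open>a - t\<close> at height \<open>c\<close>.
  The cap keeps it real even where \<open>a\<close> is infinite, so that adding its negative to
  \<open>u\<close> never produces \<infinity> - \<infinity>.\<close>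

definition excess :: "real \<Rightarrow> real \<Rightarrow> ereal \<Rightarrow> real" where
  "excess t c a = real_of_ereal (min (max (a - ereal t) 0) (ereal c))"

lemma excess_ereal: "excess t c (ereal a) = min (max (a - t) 0) c"
  by (simp add: excess_def zero_ereal_def flip: ereal_max ereal_min)

section \<open>Truncation above a level\<close>

lemma excess_PInf: "excess t c \<infinity> = c"
  by (simp add: excess_def)

lemma excess_MInf: "0 \<le> c \<Longrightarrow> excess t c (-\<infinity>) = 0"
  by (simp add: excess_def)

lemmas excess_simps = excess_ereal excess_PInf excess_MInf

lemma excess_nonneg: "0 \<le> c \<Longrightarrow> 0 \<le> excess t c a"
  by (cases a) (auto simp: excess_simps)

lemma excess_le: "0 \<le> c \<Longrightarrow> excess t c a \<le> c"
  by (cases a) (auto simp: excess_simps)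

lemma excess_eq_0: "0 \<le> c \<Longrightarrow> a \<le> ereal t \<Longrightarrow> excess t c a = 0"
  by (cases a) (auto simp: excess_simps)

lemma excess_zero [simp]: "excess t 0 a = 0"
  by (cases a) (auto simp: excess_simps)

lemma excess_ge: "h \<le> c \<Longrightarrow> ereal (t + h) < a \<Longrightarrow> h \<le> excess t c a"
  by (cases a) (auto simp: excess_simps)

text \<open>Truncation is 1-Lipschitz in the value and in the cap. If \<open>a\<close> or
  \<open>b\<close> is infinite, so is the right side, by the convention for \<infinity> -
  \<infinity>.\<close>

lemma excess_diff_le:
  assumes "0 \<le> c" "0 \<le> d"
  shows "ereal \<bar>excess t c a - excess t d b\<bar> \<le> \<bar>a - b\<bar> + ereal \<bar>c - d\<bar>"
proof (cases a; cases b)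
  fix a' b' assume "a = ereal a'" "b = ereal b'"
  then show ?thesis
    using assms by (auto simp: excess_simps min_def max_def abs_if)
qed (use assms in \<open>auto simp: excess_simps\<close>)

lemma excess_measurable [measurable (raw)]:
  assumes [measurable]: "c \<in> borel_measurable N" "f \<in> borel_measurable N"
  shows "(\<lambda>x. excess t (c x) (f x)) \<in> borel_measurable N"
  unfolding excess_def by measurable

text \<open>Values above \<open>t\<close> are lowered, but not below \<open>t\<close>. If
  \<open>a \<le> t < b\<close>, only \<open>b\<close> moves, and it moves towards \<open>a\<close>,
  so the whole decrement is gained. If both exceed \<open>t\<close>, the new values are
  \<open>max t (a - c)\<close> and \<open>max t (b - d)\<close>, whose distance exceeds that of
  \<open>a\<close> and \<open>b\<close> by at most \<open>\<bar>c - d\<bar>\<close>. In the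
  remaining cases the distance does not grow.\<close>

lemma truncation_energy_ge:
  fixes a b c d t :: real
  assumes "0 \<le> c" "0 \<le> d"
  shows "(if a \<le> t then min (max (b - t) 0) d else 0) - (if t < a \<and> t < b then \<bar>c - d\<bar> else 0)
    \<le> \<bar>a - b\<bar> - \<bar>(a - min (max (a - t) 0) c) - (b - min (max (b - t) 0) d)\<bar>"
  using assms by (auto simp: min_def max_def abs_if)

section \<open>Bounds for the integrand and admissibility of the test function\<close>

context doubling_outer begin

text \<open>This is \<open>truncation_energy_ge\<close> divided by the weight; on the diagonal every
  quotient is 0 / 0 = 0.\<close>

lemma frac_integrand_ge:
  assumes u: "\<bar>u x\<bar> \<noteq> \<infinity>" "\<bar>u y\<bar> \<noteq> \<infinity>" and c: "0 \<le> c x" "0 \<le> c y"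
  shows "enn2ereal (ennreal (if u x \<le> ereal t then excess t (c y) (u y) else 0) / frac_weight \<mu> s x y)
      - enn2ereal (ennreal (if ereal t < u x \<and> ereal t < u y then \<bar>c x - c y\<bar> else 0) / frac_weight \<mu> s x y)
    \<le> frac_integrand \<mu> s u (\<lambda>x. u x + ereal (- excess t (c x) (u x))) x y"
proof -
  obtain a b where ab: "u x = ereal a" "u y = ereal b"
    using u by (cases "u x"; cases "u y") auto
  show ?thesis
  proof (cases "x = y")
    case True
    then show ?thesis
      using ab c excess_eq_0[of "c y" "u y" t] by (simp add: frac_integrand_def)
  next
    case False
    then obtain k where k: "k > 0" "frac_weight \<mu> s x y = ennreal k"
      by (rule frac_weight_real)
    define p where "p = (if a \<le> t then min (max (b - t) 0) (c y) else 0)"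
    define n where "n = (if t < a \<and> t < b then \<bar>c x - c y\<bar> else 0)"
    define g where "g = \<bar>a - b\<bar> - \<bar>(a - min (max (a - t) 0) (c x)) - (b - min (max (b - t) 0) (c y))\<bar>"
    have pn: "0 \<le> p" "0 \<le> n" using c by (auto simp: p_def n_def)
    have "p - n \<le> g"
      unfolding p_def n_def g_def by (rule truncation_energy_ge[OF c])
    then have "(p - n) / k \<le> g / k" using k by (intro divide_right_mono) auto
    then have le: "p / k - n / k \<le> g / k" by (simp only: diff_divide_distrib)
    have "frac_integrand \<mu> s u (\<lambda>x. u x + ereal (- excess t (c x) (u x))) x y = ereal (g / k)"
      using ab k by (simp add: frac_integrand_def excess_ereal g_def)
    moreover have "(if u x \<le> ereal t then excess t (c y) (u y) else 0) = p"
      and "(if ereal t < u x \<and> ereal t < u y then \<bar>c x - c y\<bar> else 0) = n"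
      using ab by (simp_all add: p_def n_def excess_ereal)
    ultimately show ?thesis
      using le pn k by (simp add: divide_ennreal)
  qed
qed

text \<open>
  Off \<open>\<Omega>\<close> the function \<open>u\<close> may be infinite; then the integrand is \<open>0\<close> by convention, so that points
  of \<open>- \<Omega>\<close> contribute no positive term.
\<close>

lemma frac_integrand_ge_outside:
  assumes u: "\<bar>u y\<bar> \<noteq> \<infinity>" and c: "c x = 0" "0 \<le> c y"
  shows "enn2ereal 0 - enn2ereal (ennreal (if ereal t < u y then c y else 0) / frac_weight \<mu> s x y)
    \<le> frac_integrand \<mu> s u (\<lambda>x. u x + ereal (- excess t (c x) (u x))) x y"
proof (cases "\<bar>u x\<bar> = \<infinity>")
  case True
  then have "frac_integrand \<mu> s u (\<lambda>x. u x + ereal (- excess t (c x) (u x))) x y = 0"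
    using u c by (cases "u x"; cases "u y") (auto simp: frac_integrand_def)
  then show ?thesis by (simp add: zero_ennreal.rep_eq)
next
  case False
  then obtain a b where ab: "u x = ereal a" "u y = ereal b"
    using u by (cases "u x"; cases "u y") auto
  show ?thesis
  proof (cases "x = y")
    case True
    then show ?thesis
      using ab c by (simp add: frac_integrand_def)
  next
    case False
    then obtain k where k: "k > 0" "frac_weight \<mu> s x y = ennreal k"
      by (rule frac_weight_real)
    let ?n = "if t < b then c y else 0"
    let ?g = "\<bar>a - b\<bar> - \<bar>a - (b - min (max (b - t) 0) (c y))\<bar>"
    have "0 \<le> ?n" using c by auto
    moreover have "frac_integrand \<mu> s u (\<lambda>x. u x + ereal (- excess t (c x) (u x))) x y = ereal (?g / k)"
      using ab k c by (simp add: frac_integrand_def excess_ereal)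
    moreover have "- ?n \<le> ?g" using c by (auto simp: min_def max_def)
    then have "- ?n / k \<le> ?g / k" using k by (intro divide_right_mono) auto
    ultimately show ?thesis
      using ab k by (simp add: excess_ereal divide_ennreal zero_ennreal.rep_eq)
  qed
qed

lemma frac_integrand_measurable [measurable (raw)]:
  assumes [measurable]: "f \<in> N \<rightarrow>\<^sub>M M" "g \<in> N \<rightarrow>\<^sub>M M"
    "u \<in> borel_measurable M" "v \<in> borel_measurable M"
  shows "(\<lambda>z. frac_integrand \<mu> s u v (f z) (g z)) \<in> borel_measurable N"
  unfolding frac_integrand_def by measurable

text \<open>The test function is bounded by \<open>h\<close> and supported in a ball, hence
  integrable. Its differences are controlled by those of \<open>u\<close> inside \<Omega>, where the
  seminorm is finite, and by those of the cutoff everywhere.\<close>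

lemma excess_cutoff_admissible:
  assumes \<delta>: "0 < \<delta>" and h: "0 < h" and B: "ball x0 r \<subseteq> \<Omega>" and \<Omega>: "open \<Omega>"
    and [measurable]: "u \<in> borel_measurable M" and fin: "frac_seminorm \<mu> s \<Omega> u < \<infinity>"
  shows "(\<lambda>x. ereal (- excess t (h * cutoff x0 r \<delta> x) (u x))) \<in> frac_sobolev_zero \<mu> s \<Omega>"
proof -
  define \<psi> where "\<psi> = cutoff x0 r \<delta>"
  define w where "w x = excess t (h * \<psi> x) (u x)" for x
  have [measurable]: "\<psi> \<in> borel_measurable M"
    unfolding \<psi>_def by (rule cutoff_measurable[OF \<delta>])
  have [measurable]: "\<Omega> \<in> sets M" using \<Omega> by (rule open_sets)
  have \<psi>: "0 \<le> \<psi> x" "\<psi> x \<le> 1" for x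
    by (simp_all add: \<psi>_def cutoff_nonneg cutoff_le_1)
  have \<psi>0: "\<psi> x = 0" if "x \<notin> ball x0 r" for x
    using that by (simp add: \<psi>_def cutoff_eq_0[OF \<delta>])
  have [measurable]: "w \<in> borel_measurable M" unfolding w_def by measurable
  have w: "0 \<le> w x" "w x \<le> h * \<psi> x" for x
    unfolding w_def using \<psi>[of x] h by (auto intro: excess_nonneg excess_le)
  have w0: "w x = 0" if "x \<notin> ball x0 r" for x
    using w[of x] \<psi>0[OF that] by simp
  have "(\<integral>\<^sup>+x\<in>UNIV. e2ennreal \<bar>ereal (- w x)\<bar> \<partial>M) \<le> (\<integral>\<^sup>+x. ennreal h * indicator (ball x0 r) x \<partial>M)"
  proof (intro nn_integral_mono)
    fix x
    have "w x \<le> h" using w[of x] \<psi>[of x] h by (meson mult_left_le order_trans less_imp_le)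
    then show "e2ennreal \<bar>ereal (- w x)\<bar> * indicator UNIV x \<le> ennreal h * indicator (ball x0 r) x"
      using w(1)[of x] w0[of x] by (cases "x \<in> ball x0 r") (auto simp: ennreal_leI)
  qed
  also have "\<dots> < \<infinity>"
    by (simp add: nn_integral_cmult emeasure_ball_eq ennreal_mult_less_top)
  finally have L1: "(\<integral>\<^sup>+x\<in>UNIV. e2ennreal \<bar>ereal (- w x)\<bar> \<partial>M) < \<infinity>" .
  have le: "e2ennreal \<bar>ereal (- w x) - ereal (- w y)\<bar> / frac_weight \<mu> s x y
      \<le> e2ennreal \<bar>u x - u y\<bar> / frac_weight \<mu> s x y * indicator \<Omega> x * indicator \<Omega> y
        + ennreal h * (ennreal \<bar>\<psi> x - \<psi> y\<bar> / frac_weight \<mu> s x y)" for x y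
  proof -
    have eq: "h * \<bar>\<psi> x - \<psi> y\<bar> = \<bar>h * \<psi> x - h * \<psi> y\<bar>"
      using h by (simp add: abs_mult right_diff_distrib[symmetric])
    have "e2ennreal \<bar>ereal (- w x) - ereal (- w y)\<bar>
      \<le> e2ennreal \<bar>u x - u y\<bar> * indicator \<Omega> x * indicator \<Omega> y + ennreal (h * \<bar>\<psi> x - \<psi> y\<bar>)"
    proof (cases "x \<in> \<Omega> \<and> y \<in> \<Omega>")
      case True
      have "ereal \<bar>w x - w y\<bar> \<le> \<bar>u x - u y\<bar> + ereal (h * \<bar>\<psi> x - \<psi> y\<bar>)"
        unfolding w_def eq using \<psi>[of x] \<psi>[of y] h by (intro excess_diff_le) auto
      then have "e2ennreal (ereal \<bar>w x - w y\<bar>) \<le> e2ennreal (\<bar>u x - u y\<bar> + ereal (h * \<bar>\<psi> x - \<psi> y\<bar>))"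
        by (rule e2ennreal_mono)
      also have "\<dots> = e2ennreal \<bar>u x - u y\<bar> + ennreal (h * \<bar>\<psi> x - \<psi> y\<bar>)"
      proof (cases "\<bar>u x - u y\<bar>")
        case (real q)
        then have "0 \<le> q" by (metis abs_ereal_pos ereal_less_eq(5))
        then show ?thesis using real h by simp
      qed (use h in auto)
      finally show ?thesis using True by (simp add: abs_minus_commute)
    next
      case False
      \<comment> \<open>At a point off the ball both \<open>w\<close> and \<psi> vanish, so the
        bound \<open>w \<le> h * \<psi>\<close> at the other point suffices and \<open>u\<close> is
        not involved.\<close>
      then have "x \<notin> ball x0 r \<or> y \<notin> ball x0 r" using B by auto
      then have "\<bar>w x - w y\<bar> \<le> h * \<bar>\<psi> x - \<psi> y\<bar>"
        unfolding eq using w[of x] w[of y] by (elim disjE) (simp_all add: w0 \<psi>0)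
      then show ?thesis using False by (auto simp: ennreal_leI abs_minus_commute)
    qed
    then have "e2ennreal \<bar>ereal (- w x) - ereal (- w y)\<bar> / frac_weight \<mu> s x y
      \<le> (e2ennreal \<bar>u x - u y\<bar> * indicator \<Omega> x * indicator \<Omega> y + ennreal (h * \<bar>\<psi> x - \<psi> y\<bar>)) / frac_weight \<mu> s x y"
      by (rule divide_right_mono_ennreal)
    then show ?thesis
      using h by (cases "x \<in> \<Omega>"; cases "y \<in> \<Omega>")
        (simp_all add: add_divide_distrib_ennreal ennreal_mult ennreal_times_divide)
  qed
  have "frac_seminorm \<mu> s UNIV (\<lambda>x. ereal (- w x))
    \<le> (\<integral>\<^sup>+y. (\<integral>\<^sup>+x. e2ennreal \<bar>u x - u y\<bar> / frac_weight \<mu> s x y * indicator \<Omega> x * indicator \<Omega> y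
        + ennreal h * (ennreal \<bar>\<psi> x - \<psi> y\<bar> / frac_weight \<mu> s x y) \<partial>M) \<partial>M)"
    unfolding frac_seminorm_def indicator_UNIV mult_1_right by (intro nn_integral_mono le)
  also have "\<dots> = frac_seminorm \<mu> s \<Omega> u
      + ennreal h * (\<integral>\<^sup>+y\<in>UNIV. (\<integral>\<^sup>+x\<in>UNIV. (ennreal \<bar>\<psi> x - \<psi> y\<bar> / frac_weight \<mu> s x y) \<partial>M) \<partial>M)"
    unfolding frac_seminorm_def by (simp add: nn_integral_add nn_integral_multc nn_integral_cmult)
  also have "\<dots> < \<infinity>"
  proof -
    have "(\<integral>\<^sup>+y\<in>UNIV. (\<integral>\<^sup>+x\<in>UNIV. (ennreal \<bar>\<psi> x - \<psi> y\<bar> / frac_weight \<mu> s x y) \<partial>M) \<partial>M) < \<infinity>"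
      using cutoff_integral[OF \<delta>, of UNIV x0 r] sets.top[of M]
      by (auto simp: \<psi>_def emeasure_ball_eq ennreal_mult_less_top intro: order_le_less_trans)
    then show ?thesis using fin by (simp add: ennreal_mult_less_top)
  qed
  finally have "frac_norm \<mu> s UNIV (\<lambda>x. ereal (- w x)) < \<infinity>"
    unfolding frac_norm_def using L1 by simp
  moreover have "(\<lambda>x. ereal (- w x)) \<in> borel_measurable (restrict_space M UNIV)"
    by (intro measurable_restrict_space1) measurable
  moreover have "x \<notin> \<Omega> \<Longrightarrow> ereal (- w x) = 0" for x
    using w0[of x] B by (cases "x \<in> ball x0 r") auto
  ultimately show ?thesis
    unfolding frac_sobolev_zero_def frac_sobolev_def w_def \<psi>_def by simp
qed

end

text \<open>Finite losses keep \<open>i\<close> and \<open>j\<close> away from -\<infinity>; then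
  \<open>i + 2 * j \<le> 0\<close> keeps them away from \<infinity>, and the claim reduces to real
  arithmetic.\<close>

lemma ennreal_le_of_ereal_sum_le:
  assumes "enn2ereal p - enn2ereal n \<le> i" "enn2ereal 0 - enn2ereal m \<le> j" "i + 2 * j \<le> 0"
    "n < \<infinity>" "m < \<infinity>"
  shows "p \<le> n + 2 * m"
proof -
  obtain n1 m1 where nm: "n = ennreal n1" "0 \<le> n1" "m = ennreal m1" "0 \<le> m1"
    using assms by (cases n; cases m) auto
  obtain p1 where p: "p = ennreal p1" "0 \<le> p1"
    using assms nm by (cases p; cases i; cases j) (auto simp: zero_ennreal.rep_eq)
  have "p1 \<le> n1 + 2 * m1"
    using assms nm p by (cases i; cases j) (auto simp: zero_ennreal.rep_eq)
  then have "ennreal p1 \<le> ennreal (n1 + 2 * m1)" by (rule ennreal_leI)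
  then show ?thesis
    using nm p by (simp add: ennreal_mult)
qed

section \<open>The Caccioppoli-type estimate\<close>

context doubling_outer begin

text \<open>The functional dominates the gain \<open>p\<close> minus the loss \<open>n\<close> over
  \<Omega> \<times> \<Omega>, minus twice the loss \<open>m\<close> between \<Omega> and its
  complement. As it is nonpositive, the losses bound the gain. The constant is 4 = 2 + 2 * 1: the
  cutoff integral over pairs in \<Omega> contributes 2, the outside integral contributes 1, doubled
  by the functional.\<close>

lemma superlevel_energy:
  assumes \<delta>: "0 < \<delta>" and h: "0 < h" and B: "ball x0 r \<subseteq> \<Omega>" and \<Omega>: "open \<Omega>"
    and u_meas [measurable]: "u \<in> borel_measurable M"
    and u_fin: "AE x in M. x \<in> \<Omega> \<longrightarrow> \<bar>u x\<bar> \<noteq> \<infinity>"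
    and le0: "frac_functional \<mu> s \<Omega> u (\<lambda>x. u x + ereal (- excess t (h * cutoff x0 r \<delta> x) (u x))) \<le> 0"
  shows "(\<integral>\<^sup>+y\<in>\<Omega>. (\<integral>\<^sup>+x\<in>\<Omega>. (ennreal (if u x \<le> ereal t then excess t (h * cutoff x0 r \<delta> y) (u y) else 0)
      / frac_weight \<mu> s x y) \<partial>M) \<partial>M)
    \<le> ennreal (4 * tail_const * h * \<delta> powr - s) * emeasure M ({x. ereal t < u x} \<inter> ball x0 r)"
proof -
  define \<psi> where "\<psi> = cutoff x0 r \<delta>"
  have [measurable]: "\<psi> \<in> borel_measurable M"
    unfolding \<psi>_def by (rule cutoff_measurable[OF \<delta>])
  have [measurable]: "\<Omega> \<in> sets M" using \<Omega> by (rule open_sets)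
  have [measurable]: "- \<Omega> \<in> sets M" using \<Omega> by (intro borel_sets_M) auto
  have \<psi>: "0 \<le> \<psi> x" for x
    by (simp add: \<psi>_def cutoff_nonneg)
  have \<psi>0: "\<psi> x = 0" if "x \<notin> ball x0 r" for x
    using that by (simp add: \<psi>_def cutoff_eq_0[OF \<delta>])
  define c where "c x = h * \<psi> x" for x
  have [measurable]: "c \<in> borel_measurable M" unfolding c_def by measurable
  have c: "0 \<le> c x" for x using \<psi> h by (simp add: c_def)
  define v where "v x = u x + ereal (- excess t (c x) (u x))" for x
  have [measurable]: "v \<in> borel_measurable M" unfolding v_def by measurable
  \<comment> \<open>On \<Omega> \<times> \<Omega> the loss \<open>n\<close> is supported on pairs in
    \<open>D\<close>; this is what makes the measure of the superlevel set appear in the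
    bound.\<close>
  define D where "D = {x. ereal t < u x} \<inter> \<Omega>"
  have "{x \<in> space M. ereal t < u x} \<in> sets M" by measurable
  then have E_meas [measurable]: "{x. ereal t < u x} \<in> sets M" by simp
  then have D_meas [measurable]: "D \<in> sets M" by (simp add: D_def)
  have DB: "D \<inter> ball x0 r = {x. ereal t < u x} \<inter> ball x0 r" using B by (auto simp: D_def)
  define e where "e = emeasure M ({x. ereal t < u x} \<inter> ball x0 r)"
  have "e \<le> emeasure M (ball x0 r)" unfolding e_def by (intro emeasure_mono) auto
  then have e_fin: "e < \<infinity>" using emeasure_ball_less_top[of x0 r] by (rule order_le_less_trans)
  define p where "p x y = ennreal (if u x \<le> ereal t then excess t (c y) (u y) else 0) / frac_weight \<mu> s x y" for x y
  define n where "n x y = ennreal (if ereal t < u x \<and> ereal t < u y then \<bar>c x - c y\<bar> else 0) / frac_weight \<mu> s x y" for x y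
  define m where "m x y = ennreal (if ereal t < u y then c y else 0) / frac_weight \<mu> s x y" for x y
  have [measurable (raw)]: "(\<lambda>z. p (f z) (g z)) \<in> borel_measurable N"
    "(\<lambda>z. n (f z) (g z)) \<in> borel_measurable N" "(\<lambda>z. m (f z) (g z)) \<in> borel_measurable N"
    if [measurable]: "f \<in> N \<rightarrow>\<^sub>M M" "g \<in> N \<rightarrow>\<^sub>M M" for f g and N :: "'b measure"
    unfolding p_def n_def m_def by measurable
  define J where "J y = ereal_set_integral M \<Omega> (\<lambda>x. frac_integrand \<mu> s u v x y)" for y
  define J' where "J' y = ereal_set_integral M (- \<Omega>) (\<lambda>x. frac_integrand \<mu> s u v x y)" for y
  have [measurable]: "J \<in> borel_measurable M" "J' \<in> borel_measurable M"
    unfolding J_def J'_def ereal_set_integral_def by measurable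

  have c_diff: "ennreal \<bar>c x - c y\<bar> = ennreal h * ennreal \<bar>\<psi> x - \<psi> y\<bar>" for x y
    using h by (simp add: c_def abs_mult right_diff_distrib[symmetric] ennreal_mult)
  have n_le: "(\<integral>\<^sup>+y\<in>\<Omega>. (\<integral>\<^sup>+x\<in>\<Omega>. n x y \<partial>M) \<partial>M) \<le> ennreal (2 * tail_const * h * \<delta> powr - s) * e"
  proof -
    have "(\<integral>\<^sup>+y\<in>\<Omega>. (\<integral>\<^sup>+x\<in>\<Omega>. n x y \<partial>M) \<partial>M)
      = (\<integral>\<^sup>+y. (\<integral>\<^sup>+x. ennreal h * ((ennreal \<bar>\<psi> x - \<psi> y\<bar> / frac_weight \<mu> s x y) * indicator D x * indicator D y) \<partial>M) \<partial>M)"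
    proof -
      have "(\<integral>\<^sup>+y\<in>\<Omega>. (\<integral>\<^sup>+x\<in>\<Omega>. n x y \<partial>M) \<partial>M) = (\<integral>\<^sup>+y. (\<integral>\<^sup>+x. n x y * indicator \<Omega> x * indicator \<Omega> y \<partial>M) \<partial>M)"
        by (simp add: nn_integral_multc)
      moreover have "n x y * indicator \<Omega> x * indicator \<Omega> y
        = ennreal h * ((ennreal \<bar>\<psi> x - \<psi> y\<bar> / frac_weight \<mu> s x y) * indicator D x * indicator D y)" for x y
        by (auto simp: n_def D_def indicator_def c_diff ennreal_times_divide)
      ultimately show ?thesis by simp
    qed
    also have "\<dots> = ennreal h * (\<integral>\<^sup>+y\<in>D. (\<integral>\<^sup>+x\<in>D. (ennreal \<bar>\<psi> x - \<psi> y\<bar> / frac_weight \<mu> s x y) \<partial>M) \<partial>M)"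
      by (simp add: nn_integral_multc nn_integral_cmult)
    also have "\<dots> \<le> ennreal h * (ennreal (2 * tail_const * \<delta> powr - s) * e)"
      unfolding \<psi>_def e_def DB[symmetric] by (intro mult_left_mono cutoff_integral \<delta> D_meas) simp
    also have "\<dots> = ennreal (2 * tail_const * h * \<delta> powr - s) * e"
      using h tail_const_pos by (simp add: ennreal_mult mult_ac)
    finally show ?thesis .
  qed
  have m_le: "(\<integral>\<^sup>+y\<in>\<Omega>. (\<integral>\<^sup>+x\<in>- \<Omega>. m x y \<partial>M) \<partial>M) \<le> ennreal (tail_const * h * \<delta> powr - s) * e"
  proof -
    have "(\<integral>\<^sup>+x\<in>- \<Omega>. m x y \<partial>M) * indicator \<Omega> y
      \<le> ennreal (tail_const * h * \<delta> powr - s) * indicator (D \<inter> ball x0 r) y" for y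
    proof (cases "y \<in> D \<inter> ball x0 r")
      case True
      \<comment> \<open>Off \<Omega> the cutoff vanishes, so \<open>c y\<close> equals
        \<open>h * \<bar>\<psi> x - \<psi> y\<bar>\<close> there and \<open>m\<close> is again a
        cutoff quotient.\<close>
      have "(\<integral>\<^sup>+x\<in>- \<Omega>. m x y \<partial>M)
        = (\<integral>\<^sup>+x. ennreal h * ((ennreal \<bar>\<psi> x - \<psi> y\<bar> / frac_weight \<mu> s x y) * indicator (- \<Omega>) x) \<partial>M)"
      proof (intro nn_integral_cong)
        fix x
        show "m x y * indicator (- \<Omega>) x = ennreal h * ((ennreal \<bar>\<psi> x - \<psi> y\<bar> / frac_weight \<mu> s x y) * indicator (- \<Omega>) x)"
        proof (cases "x \<in> \<Omega>")
          case False
          then have "x \<notin> ball x0 r" using B by blast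
          then show ?thesis
            using True False h \<psi>[of y] by (simp add: m_def D_def c_def \<psi>0 ennreal_mult ennreal_times_divide)
        qed simp
      qed
      also have "\<dots> = ennreal h * (\<integral>\<^sup>+x\<in>- \<Omega>. (ennreal \<bar>\<psi> x - \<psi> y\<bar> / frac_weight \<mu> s x y) \<partial>M)"
        by (simp add: nn_integral_cmult)
      also have "\<dots> \<le> ennreal h * ennreal (tail_const * \<delta> powr - s)"
        using True unfolding \<psi>_def by (intro mult_left_mono cutoff_integral_outside \<delta>) auto
      also have "\<dots> = ennreal (tail_const * h * \<delta> powr - s)"
        using h tail_const_pos by (simp add: ennreal_mult mult_ac)
      finally show ?thesis using True by (simp add: D_def)
    next
      case False
      then have "y \<in> \<Omega> \<Longrightarrow> m x y = 0" for x
        using \<psi>0[of y] by (cases "y \<in> ball x0 r") (auto simp: m_def c_def D_def)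
      then show ?thesis by (cases "y \<in> \<Omega>") auto
    qed
    then have "(\<integral>\<^sup>+y\<in>\<Omega>. (\<integral>\<^sup>+x\<in>- \<Omega>. m x y \<partial>M) \<partial>M)
      \<le> (\<integral>\<^sup>+y. ennreal (tail_const * h * \<delta> powr - s) * indicator (D \<inter> ball x0 r) y \<partial>M)"
      by (intro nn_integral_mono)
    also have "\<dots> = ennreal (tail_const * h * \<delta> powr - s) * e"
      by (simp add: nn_integral_cmult e_def DB)
    finally show ?thesis .
  qed
  have n_fin: "(\<integral>\<^sup>+y\<in>\<Omega>. (\<integral>\<^sup>+x\<in>\<Omega>. n x y \<partial>M) \<partial>M) < \<infinity>"
    using e_fin by (intro order_le_less_trans[OF n_le]) (simp add: ennreal_mult_less_top)
  have m_fin: "(\<integral>\<^sup>+y\<in>\<Omega>. (\<integral>\<^sup>+x\<in>- \<Omega>. m x y \<partial>M) \<partial>M) < \<infinity>"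
    using e_fin by (intro order_le_less_trans[OF m_le]) (simp add: ennreal_mult_less_top)

  \<comment> \<open>The integral comparison is used twice: in \<open>x\<close> for almost every
    \<open>y\<close>, where finiteness of the inner loss follows from that of the double integral,
    and then in \<open>y\<close>.\<close>
  have I1: "enn2ereal (\<integral>\<^sup>+y\<in>\<Omega>. (\<integral>\<^sup>+x\<in>\<Omega>. p x y \<partial>M) \<partial>M) - enn2ereal (\<integral>\<^sup>+y\<in>\<Omega>. (\<integral>\<^sup>+x\<in>\<Omega>. n x y \<partial>M) \<partial>M)
    \<le> ereal_set_integral M \<Omega> J"
  proof (rule ereal_set_integral_ge[OF _ _ _ _ _ n_fin])
    have "AE y in M. (\<integral>\<^sup>+x\<in>\<Omega>. n x y \<partial>M) * indicator \<Omega> y \<noteq> \<infinity>"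
      using n_fin by (intro nn_integral_PInf_AE) auto
    with u_fin show "AE y in M. y \<in> \<Omega> \<longrightarrow> enn2ereal (\<integral>\<^sup>+x\<in>\<Omega>. p x y \<partial>M) - enn2ereal (\<integral>\<^sup>+x\<in>\<Omega>. n x y \<partial>M) \<le> J y"
    proof eventually_elim
      case (elim y)
      show ?case
      proof
        assume y: "y \<in> \<Omega>"
        with elim have fin: "(\<integral>\<^sup>+x\<in>\<Omega>. n x y \<partial>M) < \<infinity>" by (simp add: less_top)
        show "enn2ereal (\<integral>\<^sup>+x\<in>\<Omega>. p x y \<partial>M) - enn2ereal (\<integral>\<^sup>+x\<in>\<Omega>. n x y \<partial>M) \<le> J y"
          unfolding J_def
        proof (rule ereal_set_integral_ge[OF _ _ _ _ _ fin])
          show "AE x in M. x \<in> \<Omega> \<longrightarrow> enn2ereal (p x y) - enn2ereal (n x y) \<le> frac_integrand \<mu> s u v x y"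
            using u_fin
          proof eventually_elim
            case (elim x)
            then show ?case
              using \<open>y \<in> \<Omega> \<longrightarrow> \<bar>u y\<bar> \<noteq> \<infinity>\<close> y
              unfolding p_def n_def v_def by (intro impI frac_integrand_ge c) auto
          qed
        qed measurable
      qed
    qed
  qed measurable
  have I2: "enn2ereal 0 - enn2ereal (\<integral>\<^sup>+y\<in>\<Omega>. (\<integral>\<^sup>+x\<in>- \<Omega>. m x y \<partial>M) \<partial>M) \<le> ereal_set_integral M \<Omega> J'"
  proof -
    have "enn2ereal (\<integral>\<^sup>+y\<in>\<Omega>. 0 \<partial>M) - enn2ereal (\<integral>\<^sup>+y\<in>\<Omega>. (\<integral>\<^sup>+x\<in>- \<Omega>. m x y \<partial>M) \<partial>M)
      \<le> ereal_set_integral M \<Omega> J'"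
    proof (rule ereal_set_integral_ge[OF _ _ _ _ _ m_fin])
      have "AE y in M. (\<integral>\<^sup>+x\<in>- \<Omega>. m x y \<partial>M) * indicator \<Omega> y \<noteq> \<infinity>"
        using m_fin by (intro nn_integral_PInf_AE) auto
      with u_fin show "AE y in M. y \<in> \<Omega> \<longrightarrow> enn2ereal 0 - enn2ereal (\<integral>\<^sup>+x\<in>- \<Omega>. m x y \<partial>M) \<le> J' y"
      proof eventually_elim
        case (elim y)
        show ?case
        proof
          assume y: "y \<in> \<Omega>"
          with elim have fin: "(\<integral>\<^sup>+x\<in>- \<Omega>. m x y \<partial>M) < \<infinity>" by (simp add: less_top)
          have "enn2ereal (\<integral>\<^sup>+x\<in>- \<Omega>. 0 \<partial>M) - enn2ereal (\<integral>\<^sup>+x\<in>- \<Omega>. m x y \<partial>M) \<le> J' y"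
            unfolding J'_def
          proof (rule ereal_set_integral_ge[OF _ _ _ _ _ fin])
            show "AE x in M. x \<in> - \<Omega> \<longrightarrow> enn2ereal 0 - enn2ereal (m x y) \<le> frac_integrand \<mu> s u v x y"
            proof (intro AE_I2 impI)
              fix x assume "x \<in> - \<Omega>"
              then have "x \<notin> ball x0 r" using B by blast
              then have "c x = 0" by (simp add: c_def \<psi>0)
              then show "enn2ereal 0 - enn2ereal (m x y) \<le> frac_integrand \<mu> s u v x y"
                using \<open>y \<in> \<Omega> \<longrightarrow> \<bar>u y\<bar> \<noteq> \<infinity>\<close> y
                unfolding m_def v_def by (intro frac_integrand_ge_outside c) auto
            qed
          qed measurable
          then show "enn2ereal 0 - enn2ereal (\<integral>\<^sup>+x\<in>- \<Omega>. m x y \<partial>M) \<le> J' y" by simp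
        qed
      qed
    qed measurable
    then show ?thesis by simp
  qed
  have "ereal_set_integral M \<Omega> J + 2 * ereal_set_integral M \<Omega> J' \<le> 0"
    using le0 unfolding frac_functional_def J_def J'_def v_def c_def \<psi>_def .
  from ennreal_le_of_ereal_sum_le[OF I1 I2 this n_fin m_fin]
  have "(\<integral>\<^sup>+y\<in>\<Omega>. (\<integral>\<^sup>+x\<in>\<Omega>. p x y \<partial>M) \<partial>M)
    \<le> (\<integral>\<^sup>+y\<in>\<Omega>. (\<integral>\<^sup>+x\<in>\<Omega>. n x y \<partial>M) \<partial>M) + 2 * (\<integral>\<^sup>+y\<in>\<Omega>. (\<integral>\<^sup>+x\<in>- \<Omega>. m x y \<partial>M) \<partial>M)" .
  also have "\<dots> \<le> ennreal (2 * tail_const * h * \<delta> powr - s) * e + 2 * (ennreal (tail_const * h * \<delta> powr - s) * e)"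
    by (intro add_mono mult_left_mono n_le m_le) auto
  also have "\<dots> = ennreal (4 * tail_const * h * \<delta> powr - s) * e"
  proof -
    have "ennreal (2 * tail_const * h * \<delta> powr - s) * e + 2 * (ennreal (tail_const * h * \<delta> powr - s) * e)
      = (ennreal (2 * tail_const * h * \<delta> powr - s) + 2 * ennreal (tail_const * h * \<delta> powr - s)) * e"
      by (simp add: distrib_right mult.assoc)
    also have "2 * ennreal (tail_const * h * \<delta> powr - s) = ennreal (2 * (tail_const * h * \<delta> powr - s))"
      using tail_const_pos h by (subst ennreal_mult) auto
    also have "ennreal (2 * tail_const * h * \<delta> powr - s) + \<dots> = ennreal (4 * tail_const * h * \<delta> powr - s)"
      using tail_const_pos h by (subst ennreal_plus[symmetric]) auto
    finally show ?thesis .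
  qed
  finally show ?thesis unfolding p_def c_def \<psi>_def e_def .
qed

section \<open>Decay of a superlevel set between concentric balls\<close>

lemma superlevel_sets [simp]: "u \<in> borel_measurable M \<Longrightarrow> {x. ereal t < u x} \<in> sets M"
  using measurable_sets[of u M borel "{ereal t<..}"] by (simp add: vimage_def)

lemma emeasure_Int_ball: "emeasure M (A \<inter> ball x r) = ennreal (measure M (A \<inter> ball x r))"
proof (cases "A \<inter> ball x r \<in> sets M")
  case True
  have "emeasure M (A \<inter> ball x r) \<le> emeasure M (ball x r)" by (intro emeasure_mono) auto
  then show ?thesis
    using emeasure_ball_less_top[of x r] by (intro emeasure_eq_ennreal_measure) auto
qed (simp add: emeasure_notin_sets measure_notin_sets)

text \<open>At least half of the ball about \<open>y\<close> lies outside the superlevel set. For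
  \<open>x\<close> in that half the weight is at most \<open>C * V y \<rho> * \<rho> powr s\<close>,
  so integration cancels the volume and leaves the scale \<rho>.\<close>

lemma superlevel_complement_interaction:
  assumes \<rho>: "0 < \<rho>" "ball y \<rho> \<subseteq> ball x0 r" and h: "0 < h"
    and u_meas [measurable]: "u \<in> borel_measurable M" and y: "ereal t < u y"
    and small: "2 * measure M ({x. ereal t < u x} \<inter> ball x0 r) \<le> V y \<rho>"
  shows "ennreal (h / (2 * C * \<rho> powr s))
    \<le> (\<integral>\<^sup>+x\<in>ball x0 r. (ennreal (if u x \<le> ereal t then h else 0) / frac_weight \<mu> s x y) \<partial>M)"
proof -
  define E where "E = {x. ereal t < u x}"
  define A where "A = ball y \<rho> - E"
  have [measurable]: "E \<in> sets M" by (simp add: E_def)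
  have [measurable]: "A \<in> sets M" by (simp add: A_def)
  have V: "V y \<rho> > 0" using \<rho> V_pos by simp
  have "A \<inter> ball y \<rho> = A" by (auto simp: A_def)
  then have A: "emeasure M A = ennreal (measure M A)"
    using emeasure_Int_ball[of A y \<rho>] by simp
  have "emeasure M (ball y \<rho>) \<le> emeasure M (A \<union> (E \<inter> ball x0 r))"
    using \<rho> by (intro emeasure_mono) (auto simp: A_def)
  also have "\<dots> \<le> emeasure M A + emeasure M (E \<inter> ball x0 r)"
    by (intro emeasure_subadditive) auto
  finally have "V y \<rho> \<le> measure M A + measure M (E \<inter> ball x0 r)"
    by (simp add: A emeasure_Int_ball emeasure_ball_eq ennreal_plus[symmetric] del: ennreal_plus)
  then have half: "V y \<rho> / 2 \<le> measure M A" using small by (simp add: E_def)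
  let ?W = "C * V y \<rho> * \<rho> powr s"
  have W: "0 < ?W" using V C_ge_2 \<rho> by simp
  have "h / (2 * C * \<rho> powr s) = h / ?W * (V y \<rho> / 2)"
    using V C_ge_2 \<rho> by (simp add: field_simps)
  also have "\<dots> \<le> h / ?W * measure M A"
    using half h W by (intro mult_left_mono) auto
  finally have "ennreal (h / (2 * C * \<rho> powr s)) \<le> ennreal (h / ?W * measure M A)"
    by (rule ennreal_leI)
  also have "\<dots> = ennreal (h / ?W) * ennreal (measure M A)"
    using h W by (intro ennreal_mult) (auto intro!: divide_nonneg_pos)
  also have "\<dots> = (\<integral>\<^sup>+x. ennreal (h / ?W) * indicator A x \<partial>M)"
    by (simp add: nn_integral_cmult A)
  also have "\<dots> \<le> (\<integral>\<^sup>+x\<in>ball x0 r. (ennreal (if u x \<le> ereal t then h else 0) / frac_weight \<mu> s x y) \<partial>M)"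
  proof (intro nn_integral_mono)
    fix x
    show "ennreal (h / ?W) * indicator A x
      \<le> ennreal (if u x \<le> ereal t then h else 0) / frac_weight \<mu> s x y * indicator (ball x0 r) x"
    proof (cases "x \<in> A")
      case True
      then have "x \<in> ball y \<rho>" "u x \<le> ereal t" by (auto simp: A_def E_def)
      moreover from this have "x \<in> ball x0 r" using \<rho> by blast
      ultimately have x: "u x \<le> ereal t" "x \<in> ball x0 r" "dist x y \<le> \<rho>"
        by (auto simp: dist_commute)
      then have "x \<noteq> y" using y by auto
      then obtain k where k: "k > 0" "frac_weight \<mu> s x y = ennreal k"
        by (rule frac_weight_real)
      have "k \<le> V y (2 * \<rho>) * \<rho> powr s"
        using frac_weight_le[OF x(3)] k V_pos[of "2 * \<rho>" y] \<rho> by simp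
      also have "\<dots> \<le> ?W"
        using V_double[of \<rho> y] \<rho> by (intro mult_right_mono) auto
      finally have "h / ?W \<le> h / k"
        using h k W by (intro divide_left_mono) auto
      then show ?thesis
        using True x k h by (simp add: divide_ennreal ennreal_leI)
    qed simp
  qed
  finally show ?thesis .
qed

text \<open>The interaction of the set where \<open>u\<close> exceeds \<open>t + h\<close> is
  bounded below by density and above by \<open>superlevel_energy\<close>. Both bounds are linear in
  \<open>h\<close>, which cancels; the sets for \<open>h = 1 / (n + 1)\<close> then exhaust the
  superlevel set.\<close>

lemma superlevel_step:
  assumes \<delta>: "0 < \<delta>" and \<rho>: "0 < \<rho>" "\<rho> \<le> \<delta>" and B: "ball x0 r \<subseteq> \<Omega>" and \<Omega>: "open \<Omega>"
    and u_meas [measurable]: "u \<in> borel_measurable M"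
    and u_fin: "AE x in M. x \<in> \<Omega> \<longrightarrow> \<bar>u x\<bar> \<noteq> \<infinity>"
    and le0: "\<And>h. 0 < h \<Longrightarrow>
      frac_functional \<mu> s \<Omega> u (\<lambda>x. u x + ereal (- excess t (h * cutoff x0 r \<delta> x) (u x))) \<le> 0"
    and small: "\<And>y. y \<in> ball x0 r \<Longrightarrow> 2 * measure M ({x. ereal t < u x} \<inter> ball x0 r) \<le> V y \<rho>"
  shows "measure M ({x. ereal t < u x} \<inter> ball x0 (r - \<delta>))
    \<le> 8 * C * tail_const * (\<rho> / \<delta>) powr s * measure M ({x. ereal t < u x} \<inter> ball x0 r)"
proof -
  define e where "e = measure M ({x. ereal t < u x} \<inter> ball x0 r)"
  let ?b = "8 * C * tail_const * (\<rho> / \<delta>) powr s * e"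
  define E where "E h = {x. ereal (t + h) < u x} \<inter> ball x0 (r - \<delta>)" for h
  have [measurable]: "E h \<in> sets M" for h by (simp add: E_def)
  have b: "0 \<le> ?b" using C_ge_2 tail_const_pos by (simp add: e_def)
  have E_le: "emeasure M (E h) \<le> ennreal ?b" if h: "0 < h" for h
  proof -
    let ?\<kappa> = "h / (2 * C * \<rho> powr s)"
    have \<kappa>: "0 < ?\<kappa>" using h C_ge_2 \<rho> by simp
    have "ennreal (?\<kappa> * measure M (E h)) = ennreal ?\<kappa> * emeasure M (E h)"
      using \<kappa> by (subst ennreal_mult) (auto simp: E_def emeasure_Int_ball)
    also have "\<dots> = (\<integral>\<^sup>+y. ennreal ?\<kappa> * indicator (E h) y \<partial>M)"
      by (simp add: nn_integral_cmult)
    also have "\<dots> \<le> (\<integral>\<^sup>+y\<in>\<Omega>. (\<integral>\<^sup>+x\<in>\<Omega>. (ennreal (if u x \<le> ereal t then excess t (h * cutoff x0 r \<delta> y) (u y) else 0)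
      / frac_weight \<mu> s x y) \<partial>M) \<partial>M)"
    proof (intro nn_integral_mono)
      fix y
      show "ennreal ?\<kappa> * indicator (E h) y \<le> (\<integral>\<^sup>+x\<in>\<Omega>. (ennreal (if u x \<le> ereal t then excess t (h * cutoff x0 r \<delta> y) (u y) else 0)
        / frac_weight \<mu> s x y) \<partial>M) * indicator \<Omega> y"
      proof (cases "y \<in> E h")
        case True
        then have y: "dist x0 y < r - \<delta>" "ereal (t + h) < u y" by (auto simp: E_def)
        then have "y \<in> ball x0 r" "y \<in> \<Omega>" using \<delta> B by auto
        have "ereal t < u y" using y(2) h by (rule_tac order_less_trans[of _ "ereal (t + h)"]) auto
        \<comment> \<open>Since \<open>y\<close> is in the ball of radius
          \<open>r - \<delta>\<close>, the condition \<rho> \<le> \<delta> keeps this ball inside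
          the larger one.\<close>
        have "ball y \<rho> \<subseteq> ball x0 r"
        proof
          fix z assume "z \<in> ball y \<rho>"
          then show "z \<in> ball x0 r" using y(1) \<rho> dist_triangle[of x0 z y] by simp
        qed
        then have "ennreal ?\<kappa> \<le> (\<integral>\<^sup>+x\<in>ball x0 r. (ennreal (if u x \<le> ereal t then h else 0) / frac_weight \<mu> s x y) \<partial>M)"
          using \<rho> h u_meas \<open>ereal t < u y\<close> small[OF \<open>y \<in> ball x0 r\<close>]
          by (intro superlevel_complement_interaction) auto
        also have "\<dots> \<le> (\<integral>\<^sup>+x\<in>\<Omega>. (ennreal (if u x \<le> ereal t then excess t (h * cutoff x0 r \<delta> y) (u y) else 0)
          / frac_weight \<mu> s x y) \<partial>M)"
        proof (intro nn_integral_mono mult_mono divide_right_mono_ennreal ennreal_leI)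
          fix x
          \<comment> \<open>The cutoff is 1 at \<open>y\<close>, so the cap is \<open>h\<close> and
            it is attained because \<open>u y\<close> exceeds \<open>t + h\<close>.\<close>
          have "h \<le> excess t (h * cutoff x0 r \<delta> y) (u y)"
            using y cutoff_eq_1[OF \<delta>, of y x0 r] by (intro excess_ge) auto
          then show "(if u x \<le> ereal t then h else 0) \<le> (if u x \<le> ereal t then excess t (h * cutoff x0 r \<delta> y) (u y) else 0)"
            by simp
          show "indicator (ball x0 r) x \<le> (indicator \<Omega> x :: ennreal)"
            using B by (auto simp: indicator_def)
        qed auto
        finally show ?thesis using True \<open>y \<in> \<Omega>\<close> by simp
      qed simp
    qed
    also have "\<dots> \<le> ennreal (4 * tail_const * h * \<delta> powr - s) * emeasure M ({x. ereal t < u x} \<inter> ball x0 r)"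
      by (rule superlevel_energy[OF \<delta> h B \<Omega> u_meas u_fin le0[OF h]])
    also have "\<dots> = ennreal (4 * tail_const * h * \<delta> powr - s * e)"
      using tail_const_pos h by (simp add: emeasure_Int_ball ennreal_mult e_def)
    finally have "?\<kappa> * measure M (E h) \<le> 4 * tail_const * h * \<delta> powr - s * e"
      using tail_const_pos h by (simp add: e_def)
    \<comment> \<open>The factor 8 * C is 4 from the energy bound times the 2 * C in the denominator
      of \<open>?\<kappa>\<close>.\<close>
    also have "\<dots> = ?\<kappa> * ?b"
      using h C_ge_2 \<rho> \<delta> by (simp add: powr_divide powr_minus field_simps)
    finally have "measure M (E h) \<le> ?b" using \<kappa> by (rule mult_left_le_imp_le)
    then show ?thesis by (simp add: E_def emeasure_Int_ball ennreal_leI)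
  qed
  have union: "{x. ereal t < u x} \<inter> ball x0 (r - \<delta>) = (\<Union>n. E (1 / real (Suc n)))"
  proof (intro equalityI subsetI)
    fix x assume x: "x \<in> {x. ereal t < u x} \<inter> ball x0 (r - \<delta>)"
    have "\<exists>n. ereal (t + 1 / real (Suc n)) < u x"
    proof (cases "u x")
      case (real a)
      then obtain n where "inverse (real (Suc n)) < a - t"
        using x reals_Archimedean[of "a - t"] by auto
      then show ?thesis using real by (intro exI[of _ n]) (simp add: inverse_eq_divide)
    qed (use x in auto)
    then show "x \<in> (\<Union>n. E (1 / real (Suc n)))" using x by (auto simp: E_def)
  next
    fix x assume "x \<in> (\<Union>n. E (1 / real (Suc n)))"
    then obtain n where x: "ereal (t + 1 / real (Suc n)) < u x" "x \<in> ball x0 (r - \<delta>)"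
      by (auto simp: E_def)
    have "ereal t < u x" by (rule order_less_trans[OF _ x(1)]) simp
    then show "x \<in> {x. ereal t < u x} \<inter> ball x0 (r - \<delta>)" using x by simp
  qed
  have inc: "incseq (\<lambda>n. E (1 / real (Suc n)))"
  proof (intro incseq_SucI subsetI)
    fix n x assume "x \<in> E (1 / real (Suc n))"
    then have x: "ereal (t + 1 / real (Suc n)) < u x" "x \<in> ball x0 (r - \<delta>)"
      by (auto simp: E_def)
    have "ereal (t + 1 / real (Suc (Suc n))) < u x"
      by (rule order_le_less_trans[OF _ x(1)]) (simp add: frac_le)
    then show "x \<in> E (1 / real (Suc (Suc n)))" using x by (simp add: E_def)
  qed
  have "emeasure M ({x. ereal t < u x} \<inter> ball x0 (r - \<delta>)) = (SUP n. emeasure M (E (1 / real (Suc n))))"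
    unfolding union by (rule SUP_emeasure_incseq[OF _ inc, symmetric]) auto
  also have "\<dots> \<le> ennreal ?b" by (intro SUP_least E_le) simp
  finally show ?thesis using b by (simp add: emeasure_Int_ball e_def)
qed

section \<open>De Giorgi iteration\<close>

lemma V_power: "0 < r \<Longrightarrow> V x (2 ^ n * r) \<le> C ^ n * V x r"
proof (induction n)
  case (Suc n)
  have "V x (2 ^ Suc n * r) \<le> C * V x (2 ^ n * r)"
    using V_double[of "2 ^ n * r" x] Suc.prems by (simp add: mult.assoc)
  also have "\<dots> \<le> C * (C ^ n * V x r)"
    using Suc C_ge_2 by (intro mult_left_mono) auto
  finally show ?case by (simp add: mult.assoc)
qed simp

text \<open>The radii \<open>r k\<close> decrease from \<open>R\<close> to \<open>R / 2\<close>, and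
  the ratio \<rho> / \<delta> is kept at \<open>1 / 2 ^ N\<close>. Each step then multiplies the
  measure by at most \<open>1 / C\<close>, by the choice of \<open>N\<close>. Halving \<rho> costs
  at most a factor \<open>C\<close> in the volume of the balls of radius \<rho>, so the density
  condition of \<open>superlevel_step\<close> persists at every stage.\<close>

lemma superlevel_vanishing:
  assumes R: "0 < R" and B: "ball x0 R \<subseteq> \<Omega>" and \<Omega>: "open \<Omega>"
    and u_meas: "u \<in> borel_measurable M"
    and u_fin: "AE x in M. x \<in> \<Omega> \<longrightarrow> \<bar>u x\<bar> \<noteq> \<infinity>"
    and le0: "\<And>h r \<delta>. 0 < h \<Longrightarrow> 0 < \<delta> \<Longrightarrow> ball x0 r \<subseteq> \<Omega> \<Longrightarrow>
      frac_functional \<mu> s \<Omega> u (\<lambda>x. u x + ereal (- excess t (h * cutoff x0 r \<delta> x) (u x))) \<le> 0"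
    and N: "8 * C * tail_const * (1 / 2 ^ N) powr s \<le> 1 / C"
    and small: "measure M ({x. ereal t < u x} \<inter> ball x0 R) \<le> V x0 R / (2 * C ^ (N + 3))"
  shows "emeasure M ({x. ereal t < u x} \<inter> ball x0 (R / 2)) = 0"
proof -
  define m where "m r = measure M ({x. ereal t < u x} \<inter> ball x0 r)" for r
  define r where "r k = R / 2 + R / 2 ^ Suc k" for k
  have m_mono: "m p \<le> m q" if "p \<le> q" for p q
  proof -
    have "emeasure M ({x. ereal t < u x} \<inter> ball x0 p) \<le> emeasure M ({x. ereal t < u x} \<inter> ball x0 q)"
      using that u_meas by (intro emeasure_mono) auto
    then show ?thesis by (simp add: emeasure_Int_ball m_def)
  qed
  have bound: "m (r k) \<le> V x0 R / (2 * C ^ (N + 3)) / C ^ k" for k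
  proof (induction k)
    case 0
    then show ?case using small by (simp add: m_def r_def)
  next
    case (Suc k)
    define \<delta> where "\<delta> = R / 2 ^ (k + 2)"
    define \<rho> where "\<rho> = R / 2 ^ (N + k + 2)"
    have \<delta>: "0 < \<delta>" and \<rho>: "0 < \<rho>" using R by (auto simp: \<delta>_def \<rho>_def)
    have \<rho>\<delta>: "\<rho> = \<delta> * (1 / 2 ^ N)" by (simp add: \<rho>_def \<delta>_def power_add)
    then have "\<rho> \<le> \<delta>" using \<delta> by (simp add: divide_le_eq)
    have "R / 2 ^ Suc k \<le> R / 2"
      using R by (intro divide_left_mono) auto
    then have rk: "r k \<le> R" by (simp add: r_def)
    then have Bk: "ball x0 (r k) \<subseteq> \<Omega>" using B by auto
    have "2 * m (r k) \<le> V y \<rho>" if y: "y \<in> ball x0 (r k)" for y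
    proof -
      \<comment> \<open>\<open>N + k + 3\<close> doublings enlarge the ball of radius \<rho> to
        radius \<open>2 * R\<close>, which covers \<open>ball x0 R\<close>. This accounts for the
        exponent \<open>N + 3\<close> in the smallness assumption.\<close>
      have "2 ^ (N + k + 3) * \<rho> = 2 * R" by (simp add: \<rho>_def power_add)
      then have "V y (2 * R) \<le> C ^ (N + k + 3) * V y \<rho>"
        using V_power[OF \<rho>, of y "N + k + 3"] by simp
      moreover have "V x0 R \<le> V y (2 * R)"
      proof (intro V_mono subsetI)
        fix z assume "z \<in> ball x0 R"
        then show "z \<in> ball y (2 * R)"
          using y rk dist_triangle[of y z x0] by (simp add: dist_commute)
      qed
      ultimately have "V x0 R / C ^ (N + k + 3) \<le> V y \<rho>"
        using C_ge_2 by (simp add: divide_le_eq mult.commute)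
      moreover have "2 * (V x0 R / (2 * C ^ (N + 3)) / C ^ k) = V x0 R / C ^ (N + k + 3)"
        by (simp add: power_add mult_ac)
      ultimately show ?thesis using Suc.IH by linarith
    qed
    then have "m (r k - \<delta>) \<le> 8 * C * tail_const * (\<rho> / \<delta>) powr s * m (r k)"
      unfolding m_def
      by (intro superlevel_step[OF \<delta> \<rho> \<open>\<rho> \<le> \<delta>\<close> Bk \<Omega> u_meas u_fin le0[OF _ \<delta> Bk]])
    also have "\<rho> / \<delta> = 1 / 2 ^ N" using \<delta> by (simp add: \<rho>\<delta>)
    also have "8 * C * tail_const * (1 / 2 ^ N) powr s * m (r k) \<le> 1 / C * m (r k)"
      by (intro mult_right_mono N) (simp add: m_def)
    also have "\<dots> \<le> 1 / C * (V x0 R / (2 * C ^ (N + 3)) / C ^ k)"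
      using C_ge_2 by (intro mult_left_mono Suc.IH) auto
    also have "r k - \<delta> = r (Suc k)"
      by (simp add: r_def \<delta>_def field_simps)
    finally show ?case by (simp add: mult_ac)
  qed
  have "m (R / 2) \<le> V x0 R / (2 * C ^ (N + 3)) * (1 / C) ^ k" for k
    using order_trans[OF m_mono[of "R / 2" "r k"] bound[of k]] R
    by (simp add: r_def power_one_over)
  moreover have "(\<lambda>k. V x0 R / (2 * C ^ (N + 3)) * (1 / C) ^ k) \<longlonglongrightarrow> V x0 R / (2 * C ^ (N + 3)) * 0"
    using C_ge_2 by (intro tendsto_mult_left LIMSEQ_power_zero) auto
  ultimately have "m (R / 2) \<le> V x0 R / (2 * C ^ (N + 3)) * 0"
    by (intro LIMSEQ_le_const) auto
  then have "m (R / 2) = 0" by (simp add: m_def measure_le_0_iff)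
  then show ?thesis by (simp add: emeasure_Int_ball m_def)
qed

end

section \<open>Semicontinuity\<close>

text \<open>Reflection of the thresholds at 0 maps one admissible set onto the other, and negation
  exchanges infimum and supremum.\<close>

lemma approx_upper_limit_uminus:
  "approx_upper_limit \<mu> (\<lambda>x. - u x) x = - approx_lower_limit \<mu> u x"
proof -
  let ?L = "{ereal t |t. ((\<lambda>r. \<mu> {y \<in> ball x r. u y < ereal t} / \<mu> (ball x r)) \<longlongrightarrow> 0) (at_right 0)}"
  let ?U = "{ereal t |t. ((\<lambda>r. \<mu> {y \<in> ball x r. - u y > ereal t} / \<mu> (ball x r)) \<longlongrightarrow> 0) (at_right 0)}"
  have iff: "ereal t < - a \<longleftrightarrow> a < ereal (- t)" for t a
    by (metis ereal_less_uminus_reorder uminus_ereal.simps(1))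
  have "?U = uminus ` ?L"
  proof (intro equalityI subsetI)
    fix z assume "z \<in> ?U"
    then obtain t where "z = ereal t"
      "((\<lambda>r. \<mu> {y \<in> ball x r. u y < ereal (- t)} / \<mu> (ball x r)) \<longlongrightarrow> 0) (at_right 0)"
      by (auto simp: iff)
    then show "z \<in> uminus ` ?L" by (intro image_eqI[of _ _ "ereal (- t)"]) auto
  next
    fix z assume "z \<in> uminus ` ?L"
    then obtain t where "z = ereal (- t)"
      "((\<lambda>r. \<mu> {y \<in> ball x r. u y < ereal t} / \<mu> (ball x r)) \<longlongrightarrow> 0) (at_right 0)"
      by auto
    then show "z \<in> ?U" by (auto simp: iff)
  qed
  then show ?thesis
    unfolding approx_upper_limit_def approx_lower_limit_def by (simp add: ereal_Inf_uminus_image_eq)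
qed

lemma lower_semicontinuous_on_uminus:
  assumes "upper_semicontinuous_on S (\<lambda>x. - f x)"
  shows "lower_semicontinuous_on S f"
  unfolding lower_semicontinuous_on_def
proof (intro ballI allI impI)
  fix x a assume "x \<in> S" "a < f x"
  then have "- f x < - a" by simp
  with \<open>x \<in> S\<close> have "\<forall>\<^sub>F y in at x within S. - f y < - a"
    using assms unfolding upper_semicontinuous_on_def by blast
  then show "\<forall>\<^sub>F y in at x within S. a < f y" by simp
qed

lemma abs_ereal_uminus_diff: "\<bar>- a - - b\<bar> = \<bar>a - b\<bar>" for a b :: ereal
  by (cases a; cases b) auto

lemma frac_integrand_uminus:
  "frac_integrand \<mu> s (\<lambda>x. - u x) (\<lambda>x. - v x) = frac_integrand \<mu> s u v"
  by (intro ext) (simp only: frac_integrand_def abs_ereal_uminus_diff)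

lemma frac_seminorm_uminus: "frac_seminorm \<mu> s A (\<lambda>x. - u x) = frac_seminorm \<mu> s A u"
  by (simp only: frac_seminorm_def abs_ereal_uminus_diff)

section \<open>Upper semicontinuity and its dual\<close>

context doubling_outer begin

text \<open>
  Since \<open>\<bar>\<infinity> - \<infinity>\<bar> = \<infinity>\<close>, a point where \<open>u\<close> is infinite interacts infinitely with all other points of
  \<open>\<Omega>\<close>. For one-point \<open>\<Omega>\<close> there is only the diagonal, where the weight vanishes.
\<close>

lemma AE_finite:
  assumes \<Omega>: "open \<Omega>" "x0 \<in> \<Omega>" "z0 \<in> \<Omega>" "x0 \<noteq> z0"
    and [measurable]: "u \<in> borel_measurable M"
    and fin: "frac_seminorm \<mu> s \<Omega> u < \<infinity>"
  shows "AE x in M. x \<in> \<Omega> \<longrightarrow> \<bar>u x\<bar> \<noteq> \<infinity>"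
proof -
  have [measurable]: "\<Omega> \<in> sets M" using \<Omega> by (intro open_sets)
  have "AE y in M. (\<integral>\<^sup>+x\<in>\<Omega>. (e2ennreal \<bar>u x - u y\<bar> / frac_weight \<mu> s x y) \<partial>M) * indicator \<Omega> y \<noteq> \<infinity>"
    using fin unfolding frac_seminorm_def by (intro nn_integral_PInf_AE) auto
  then show ?thesis
  proof eventually_elim
    case (elim y)
    show ?case
    proof (intro impI notI)
      assume y: "y \<in> \<Omega>" "\<bar>u y\<bar> = \<infinity>"
      have "\<exists>z\<in>\<Omega>. z \<noteq> y" using \<Omega> by metis
      then obtain z where z: "z \<in> \<Omega>" "z \<noteq> y" by auto
      have "open (\<Omega> - {y})" using \<Omega> by (intro open_Diff) auto
      then obtain e where e: "0 < e" "ball z e \<subseteq> \<Omega> - {y}"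
        using z by (meson Diff_iff openE singletonD)
      have "\<infinity> = (\<integral>\<^sup>+x. \<infinity> * indicator (ball z e) x \<partial>M)"
        using V_pos[OF e(1), of z]
        by (subst nn_integral_cmult_indicator) (auto simp: emeasure_ball_eq ennreal_top_mult)
      also have "\<dots> \<le> (\<integral>\<^sup>+x\<in>\<Omega>. (e2ennreal \<bar>u x - u y\<bar> / frac_weight \<mu> s x y) \<partial>M)"
      proof (intro nn_integral_mono)
        fix x
        show "\<infinity> * indicator (ball z e) x \<le> e2ennreal \<bar>u x - u y\<bar> / frac_weight \<mu> s x y * indicator \<Omega> x"
        proof (cases "x \<in> ball z e")
          case True
          then have x: "x \<in> \<Omega>" "x \<noteq> y" using e by auto
          then obtain k where "k > 0" "frac_weight \<mu> s x y = ennreal k"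
            by (auto elim: frac_weight_real)
          moreover have "\<bar>u x - u y\<bar> = \<infinity>" using y by (cases "u x"; cases "u y") auto
          ultimately show ?thesis using x by (simp add: ennreal_top_divide)
        qed simp
      qed
      finally show False using elim y by (simp add: top_unique)
    qed
  qed
qed

text \<open>If \<open>{u > t}\<close> has density 0 at \<open>x\<close>, it is null in a ball about
  \<open>x\<close>, so \<open>t\<close> is an admissible threshold at every nearby point. The test
  functions are real-valued, which lets the lemma apply to \<open>u\<close> and, after a change of
  sign, to \<open>- u\<close>.\<close>

lemma approx_upper_limit_usc:
  assumes \<Omega>: "open \<Omega>"
    and u_meas [measurable]: "u \<in> borel_measurable M"
    and fin: "frac_seminorm \<mu> s \<Omega> u < \<infinity>"
    and min: "\<And>\<eta>::'a \<Rightarrow> real. (\<And>x. 0 \<le> \<eta> x) \<Longrightarrow> (\<lambda>x. ereal (- \<eta> x)) \<in> frac_sobolev_zero \<mu> s \<Omega> \<Longrightarrow>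
      frac_functional \<mu> s \<Omega> u (\<lambda>x. u x + ereal (- \<eta> x)) \<le> 0"
  shows "upper_semicontinuous_on \<Omega> (approx_upper_limit \<mu> u)"
  unfolding upper_semicontinuous_on_def
proof (intro ballI allI impI)
  fix x a assume x: "x \<in> \<Omega>" and a: "approx_upper_limit \<mu> u x < a"
  show "\<forall>\<^sub>F y in at x within \<Omega>. approx_upper_limit \<mu> u y < a"
  \<comment> \<open>If \<Omega> is a single point, there is no other point of \<Omega> to check.
    Otherwise a second point is available for \<open>AE_finite\<close>.\<close>
  proof (cases "\<Omega> = {x}")
    case True
    then show ?thesis by (auto simp: eventually_at intro: exI[of _ 1])
  next
    case False
    then obtain z where "z \<in> \<Omega>" "z \<noteq> x" using x by auto
    then have u_fin: "AE x in M. x \<in> \<Omega> \<longrightarrow> \<bar>u x\<bar> \<noteq> \<infinity>"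
      using AE_finite[OF \<Omega> x] fin u_meas by metis
    have le0: "frac_functional \<mu> s \<Omega> u (\<lambda>x. u x + ereal (- excess t (h * cutoff x0 r \<delta> x) (u x))) \<le> 0"
      if "0 < h" "0 < \<delta>" "ball x0 r \<subseteq> \<Omega>" for t h \<delta> r and x0 :: 'a
      using that cutoff_nonneg[of x0 r \<delta>]
      by (intro min excess_nonneg excess_cutoff_admissible[OF _ _ _ \<Omega> u_meas fin]) auto
    obtain N :: nat where N: "8 * C * tail_const * (1 / 2 ^ N) powr s \<le> 1 / C"
    proof -
      \<comment> \<open>The bound on \<open>2 powr - s\<close> to the power \<open>N\<close> that
        makes the contraction factor at most \<open>1 / C\<close>.\<close>
      let ?c = "1 / (8 * C * C * tail_const)"
      have c: "0 < ?c" using C_ge_2 tail_const_pos by simp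
      obtain N where "(2 powr - s) ^ N < ?c"
        using real_arch_pow_inv[OF c powr_ratios(2)] by blast
      moreover have "(1 / 2 ^ N) powr s = (2 powr - s) ^ N"
      proof -
        have "(1 / 2 ^ N) powr s = (2 powr - real N) powr s"
          by (simp add: powr_minus powr_realpow inverse_eq_divide)
        also have "\<dots> = (2 powr - s) powr real N"
          by (simp add: powr_powr mult.commute)
        also have "\<dots> = (2 powr - s) ^ N" by (simp add: powr_realpow)
        finally show ?thesis .
      qed
      ultimately have "8 * C * tail_const * (1 / 2 ^ N) powr s \<le> 8 * C * tail_const * ?c"
        using C_ge_2 tail_const_pos by (intro mult_left_mono) auto
      also have "\<dots> = 1 / C" using C_ge_2 tail_const_pos by simp
      finally show ?thesis by (rule that)
    qed
    obtain t where t: "ereal t < a"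
      and lim: "((\<lambda>r. \<mu> {y \<in> ball x r. u y > ereal t} / \<mu> (ball x r)) \<longlongrightarrow> 0) (at_right 0)"
      using a unfolding approx_upper_limit_def Inf_less_iff by auto
    let ?E = "{y. ereal t < u y}"
    have "0 < ennreal (1 / (2 * C ^ (N + 3)))" using C_ge_2 by simp
    from order_tendstoD(2)[OF lim this]
    obtain b where b: "0 < b" and dens: "\<And>r. 0 < r \<Longrightarrow> r < b \<Longrightarrow>
        \<mu> {y \<in> ball x r. u y > ereal t} / \<mu> (ball x r) < ennreal (1 / (2 * C ^ (N + 3)))"
      by (auto simp: eventually_at_right_field)
    obtain e where e: "0 < e" "ball x e \<subseteq> \<Omega>" using \<Omega> x openE by blast
    define R where "R = min b e / 2"
    have R: "0 < R" "R < b" "R \<le> e" using b e by (auto simp: R_def)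
    have BR: "ball x R \<subseteq> \<Omega>" using R e by (meson subset_ball order_trans)
    have set_eq: "{y \<in> ball z q. u y > ereal t} = ?E \<inter> ball z q" for z q by auto
    have \<mu>_eq: "\<mu> (?E \<inter> ball z q) = emeasure M (?E \<inter> ball z q)" for z q
      by (simp add: emeasure_M)
    have "ennreal (measure M (?E \<inter> ball x R) / V x R) < ennreal (1 / (2 * C ^ (N + 3)))"
      using dens[OF R(1,2), unfolded set_eq \<mu>_eq] V_pos[OF R(1), of x]
      by (simp add: emeasure_Int_ball emeasure_ball[symmetric] emeasure_ball_eq divide_ennreal)
    then have "measure M (?E \<inter> ball x R) / V x R < 1 / (2 * C ^ (N + 3))"
      by (simp add: ennreal_less_iff)
    then have small: "measure M (?E \<inter> ball x R) \<le> V x R / (2 * C ^ (N + 3))"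
      using V_pos[OF R(1), of x] C_ge_2 by (simp add: field_simps)
    have null: "emeasure M (?E \<inter> ball x (R / 2)) = 0"
      by (rule superlevel_vanishing[OF R(1) BR \<Omega> u_meas u_fin le0 N small])
    have "approx_upper_limit \<mu> u z < a" if z: "dist z x < R / 2" for z
    proof -
      \<comment> \<open>Balls about \<open>z\<close> of radius below \<open>R / 2 - dist z x\<close>
        stay inside the ball where the superlevel set is null.\<close>
      have "\<forall>\<^sub>F q in at_right 0. \<mu> {y \<in> ball z q. u y > ereal t} / \<mu> (ball z q) = 0"
      proof (rule eventually_at_rightI[of 0 "R / 2 - dist z x"])
        fix q assume q: "q \<in> {0<..<R / 2 - dist z x}"
        have "?E \<inter> ball z q \<subseteq> ?E \<inter> ball x (R / 2)"
        proof
          fix y assume "y \<in> ?E \<inter> ball z q"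
          then show "y \<in> ?E \<inter> ball x (R / 2)"
            using q dist_triangle[of x y z] by (auto simp: dist_commute)
        qed
        then have "emeasure M (?E \<inter> ball z q) \<le> 0"
          unfolding null[symmetric] by (intro emeasure_mono) auto
        then show "\<mu> {y \<in> ball z q. u y > ereal t} / \<mu> (ball z q) = 0"
          unfolding set_eq \<mu>_eq by simp
      qed (use z in simp)
      then have "approx_upper_limit \<mu> u z \<le> ereal t"
        unfolding approx_upper_limit_def by (intro Inf_lower) (auto intro: tendsto_eventually)
      then show ?thesis using t by (rule order_le_less_trans)
    qed
    then show ?thesis
      using R by (auto simp: eventually_at intro!: exI[of _ "R / 2"])
  qed
qed

lemma subminimizer_usc:
  assumes \<Omega>: "open \<Omega>" and u: "s_subminimizer \<mu> s \<Omega> u"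
  shows "upper_semicontinuous_on \<Omega> (approx_upper_limit \<mu> u)"
proof (rule approx_upper_limit_usc[OF \<Omega>])
  show "u \<in> borel_measurable M" "frac_seminorm \<mu> s \<Omega> u < \<infinity>"
    using u by (auto simp: s_subminimizer_def hom_frac_sobolev_def)
  fix \<eta> :: "'a \<Rightarrow> real"
  assume "\<And>x. 0 \<le> \<eta> x" "(\<lambda>x. ereal (- \<eta> x)) \<in> frac_sobolev_zero \<mu> s \<Omega>"
  then show "frac_functional \<mu> s \<Omega> u (\<lambda>x. u x + ereal (- \<eta> x)) \<le> 0"
    using u by (simp add: s_subminimizer_def)
qed

text \<open>Negation leaves seminorm and functional unchanged, so \<open>- u\<close> passes the
  tests of \<open>approx_upper_limit_usc\<close>.\<close>

lemma superminimizer_lsc: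
  assumes \<Omega>: "open \<Omega>" and u: "s_superminimizer \<mu> s \<Omega> u"
  shows "lower_semicontinuous_on \<Omega> (approx_lower_limit \<mu> u)"
proof (rule lower_semicontinuous_on_uminus)
  have "upper_semicontinuous_on \<Omega> (approx_upper_limit \<mu> (\<lambda>x. - u x))"
  proof (rule approx_upper_limit_usc[OF \<Omega>])
    have [measurable]: "u \<in> borel_measurable M" and fin: "frac_seminorm \<mu> s \<Omega> u < \<infinity>"
      using u by (auto simp: s_superminimizer_def hom_frac_sobolev_def)
    show "(\<lambda>x. - u x) \<in> borel_measurable M" by measurable
    show "frac_seminorm \<mu> s \<Omega> (\<lambda>x. - u x) < \<infinity>"
      using fin by (simp only: frac_seminorm_uminus)
    fix \<eta> :: "'a \<Rightarrow> real"
    assume \<eta>: "\<And>x. 0 \<le> \<eta> x" and zero: "(\<lambda>x. ereal (- \<eta> x)) \<in> frac_sobolev_zero \<mu> s \<Omega>"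
    have eq: "(\<lambda>x. ereal (- \<eta> x)) = (\<lambda>x. - ereal (\<eta> x))" by simp
    have "(\<lambda>x. - ereal (\<eta> x)) \<in> borel_measurable (restrict_space M UNIV)"
      using zero unfolding eq by (simp add: frac_sobolev_zero_def frac_sobolev_def)
    then have "(\<lambda>x. - (- ereal (\<eta> x))) \<in> borel_measurable (restrict_space M UNIV)"
      by (rule borel_measurable_uminus_ereal)
    moreover have "frac_norm \<mu> s UNIV (\<lambda>x. ereal (\<eta> x)) = frac_norm \<mu> s UNIV (\<lambda>x. - ereal (\<eta> x))"
      unfolding frac_norm_def frac_seminorm_uminus by simp
    ultimately have "(\<lambda>x. ereal (\<eta> x)) \<in> frac_sobolev_zero \<mu> s \<Omega>"
      using zero unfolding eq by (simp add: frac_sobolev_zero_def frac_sobolev_def)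
    then have "frac_functional \<mu> s \<Omega> u (\<lambda>x. u x + ereal (\<eta> x)) \<le> 0"
      using u \<eta> by (simp add: s_superminimizer_def)
    \<comment> \<open>Since \<eta> is finite, negation distributes over the sum even where
      \<open>u\<close> is infinite.\<close>
    moreover have "(\<lambda>x. - u x + ereal (- \<eta> x)) = (\<lambda>x. - (u x + ereal (\<eta> x)))"
    proof
      show "- u x + ereal (- \<eta> x) = - (u x + ereal (\<eta> x))" for x by (cases "u x") auto
    qed
    ultimately show "frac_functional \<mu> s \<Omega> (\<lambda>x. - u x) (\<lambda>x. - u x + ereal (- \<eta> x)) \<le> 0"
      unfolding frac_functional_def by (simp only: frac_integrand_uminus)
  qed
  then show "upper_semicontinuous_on \<Omega> (\<lambda>x. - approx_lower_limit \<mu> u x)"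
    by (simp only: approx_upper_limit_uminus[abs_def])
qed

end

theorem corollary1p2:
  fixes \<mu> :: "'a::polish_space set \<Rightarrow> ennreal" and s :: real and \<Omega> :: "'a set"
  assumes "borel_regular_outer \<mu>" and "locally_finite_outer \<mu>" and "doubling \<mu>"
    and "connected (UNIV :: 'a set)"
    and "0 < s" and "s < 1"
    and "open \<Omega>" and "\<Omega> \<noteq> {}"
  shows "(\<forall>u. s_superminimizer \<mu> s \<Omega> u \<longrightarrow> lower_semicontinuous_on \<Omega> (approx_lower_limit \<mu> u)) \<and>
         (\<forall>u. s_subminimizer \<mu> s \<Omega> u \<longrightarrow> upper_semicontinuous_on \<Omega> (approx_upper_limit \<mu> u))"
proof -
  obtain C where C: "\<And>x r. r > 0 \<Longrightarrow> 0 < \<mu> (ball x r) \<and> \<mu> (ball x r) < \<infinity> \<and>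
      \<mu> (ball x (2 * r)) \<le> ennreal C * \<mu> (ball x r)"
    using \<open>doubling \<mu>\<close> unfolding doubling_def by blast
  have "\<mu> (ball x (2 * r)) \<le> ennreal (max 2 C) * \<mu> (ball x r)" if "r > 0" for x r
    using C[OF that, of x] by (meson ennreal_leI max.cobounded2 mult_right_mono order_trans zero_le)
  then interpret doubling_outer \<mu> s "max 2 C"
    using assms C by unfold_locales auto
  show ?thesis
    using superminimizer_lsc[OF \<open>open \<Omega>\<close>] subminimizer_usc[OF \<open>open \<Omega>\<close>] by blast
qed

end
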